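(* For every $K\ge1$ there exists a constant $C=C_K\ge1$ depending only on $K$ such that the following holds. Let $\Omega\subset\mathbb{R}^d$ be compact, $\mu$ a probability measure on $\Omega$, and $\Phi_N=\{\varphi_j\}_{j=1}^N$ a dictionary of continuous functions on $\Omega$ satisfying $\sup_{x\in\Omega}|\varphi_j(x)|\le1$ for $1\le j\le N$ and $\sum_{j=1}^N|a_j|^2\le K\|\sum_{j=1}^Na_j\varphi_j\|_{L_2(\Omega,\mu)}^2$ for all $(a_1,\dots,a_N)\in\mathbb{C}^N$. Then for any compact subset $\mathbf{F}$ of $\mathcal{C}(\Omega)$, any integers $1\le v\le N$ and any integer $$m\ge C\,v(\log N)\log^2(2v)(\log(2v)+\log\log N),$$ we have $$\varrho^{ls}_{m,v}(\mathbf{F},\Phi_N,L_2(\Omega,\mu))\le5\sqrt2\,\sigma_v(\mathbf{F},\Phi_N)_{(2,m)}\quad\text{and}\quad \varrho^{ls}_{m,v}(\mathbf{F},\Phi_N,L_2(\Omega,\mu))\le5\,\sigma_v(\mathbf{F},\Phi_N)_\infty.$$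
   Context: $\|f\|_2=(\int_\Omega|f|^2d\mu)^{1/2}$, $\|f\|_\infty=\max_{x\in\Omega}|f(x)|$. For a dictionary $\Phi_N$, $\mathcal{X}_v(\Phi_N)$ is the collection of linear spaces $\operatorname{span}\{\varphi_j:j\in J\}$, $J\subset\{1,\dots,N\}$, $|J|=v$; $\Sigma_v(\Phi_N)$ is their union; $\sigma_v(f,\Phi_N)_X=\inf_{g\in\Sigma_v(\Phi_N)}\|f-g\|_X$, $\sigma_v(\mathbf{F},\Phi_N)_X=\sup_{f\in\mathbf{F}}\sigma_v(f,\Phi_N)_X$. For $\xi=\{\xi^1,\dots,\xi^m\}\subset\Omega$, $\mu_\xi=\frac12\mu+\frac1{2m}\sum_{j=1}^m\delta_{\xi^j}$, and $\sigma_v(\mathbf{F},\Phi_N)_{(2,m)}:=\sup_{\{\xi^1,\dots,\xi^m\}\subset\Omega}\sigma_v(\mathbf{F},\Phi_N)_{L_2(\Omega,\mu_\xi)}$. For a finite-dimensional subspace $L$, $LS(\xi,L)(f)$ is an element $u\in L$ minimizing $\frac1m\sum_{j=1}^m|f(\xi^j)-u(\xi^j)|^2$, and $\varrho^{ls}_{m,v}(\mathbf{F},\Phi_N,L_2(\Omega,\mu)):=\inf_{\xi\in\Omega^m}\sup_{f\in\mathbf{F}}\min_{L\in\mathcal{X}_v(\Phi_N)}\|f-LS(\xi,L)(f)\|_2$. *)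

theory Defs
  imports "HOL-Probability.Probability"
begin

text \<open>A dictionary is given as a family phi :: nat => 'a => complex, indexed by 1..N.\<close>

definition L2norm :: "'a measure \<Rightarrow> ('a \<Rightarrow> complex) \<Rightarrow> real" where
  "L2norm M f = sqrt (\<integral>x. (cmod (f x))^2 \<partial>M)"

definition supnorm :: "'a set \<Rightarrow> ('a \<Rightarrow> complex) \<Rightarrow> ennreal" where
  "supnorm \<Omega> f = (SUP x\<in>\<Omega>. ennreal (cmod (f x)))"

text \<open>Norm of L2(Omega, mu_xi), mu_xi = 1/2 mu + 1/(2m) sum_j delta_(xi j), written out.\<close>
definition norm_mu_xi :: "'a measure \<Rightarrow> (nat \<Rightarrow> 'a) \<Rightarrow> nat \<Rightarrow> ('a \<Rightarrow> complex) \<Rightarrow> ennreal" where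
  "norm_mu_xi M \<xi> m f = ennreal (sqrt ((1/2) * (\<integral>x. (cmod (f x))^2 \<partial>M)
        + (1 / (2 * real m)) * (\<Sum>j<m. (cmod (f (\<xi> j)))^2)))"

definition dict_span :: "(nat \<Rightarrow> 'a \<Rightarrow> complex) \<Rightarrow> nat set \<Rightarrow> ('a \<Rightarrow> complex) set" where
  "dict_span \<phi> J = {(\<lambda>x. \<Sum>j\<in>J. c j * \<phi> j x) | c. True}"

definition subsets_v :: "nat \<Rightarrow> nat \<Rightarrow> nat set set" where
  "subsets_v N v = {J. J \<subseteq> {1..N} \<and> card J = v}"

definition Sigma_v :: "(nat \<Rightarrow> 'a \<Rightarrow> complex) \<Rightarrow> nat \<Rightarrow> nat \<Rightarrow> ('a \<Rightarrow> complex) set" where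
  "Sigma_v \<phi> N v = (\<Union>J\<in>subsets_v N v. dict_span \<phi> J)"

definition sigma_v :: "(('a \<Rightarrow> complex) \<Rightarrow> ennreal) \<Rightarrow> ('a \<Rightarrow> complex) set
     \<Rightarrow> (nat \<Rightarrow> 'a \<Rightarrow> complex) \<Rightarrow> nat \<Rightarrow> nat \<Rightarrow> ennreal" where
  "sigma_v nrm F \<phi> N v = (SUP f\<in>F. INF g\<in>Sigma_v \<phi> N v. nrm (\<lambda>x. f x - g x))"

definition points :: "'a set \<Rightarrow> nat \<Rightarrow> (nat \<Rightarrow> 'a) set" where
  "points \<Omega> m = {\<xi>. \<forall>j<m. \<xi> j \<in> \<Omega>}"

definition sigma_2m :: "'a set \<Rightarrow> 'a measure \<Rightarrow> nat \<Rightarrow> ('a \<Rightarrow> complex) set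
     \<Rightarrow> (nat \<Rightarrow> 'a \<Rightarrow> complex) \<Rightarrow> nat \<Rightarrow> nat \<Rightarrow> ennreal" where
  "sigma_2m \<Omega> M m F \<phi> N v = (SUP \<xi>\<in>points \<Omega> m. sigma_v (norm_mu_xi M \<xi> m) F \<phi> N v)"

definition is_LS :: "nat \<Rightarrow> (nat \<Rightarrow> 'a) \<Rightarrow> ('a \<Rightarrow> complex) set \<Rightarrow> ('a \<Rightarrow> complex)
     \<Rightarrow> ('a \<Rightarrow> complex) \<Rightarrow> bool" where
  "is_LS m \<xi> L f u \<longleftrightarrow> u \<in> L \<and>
     (\<forall>w\<in>L. (1 / real m) * (\<Sum>j<m. (cmod (f (\<xi> j) - u (\<xi> j)))^2)
            \<le> (1 / real m) * (\<Sum>j<m. (cmod (f (\<xi> j) - w (\<xi> j)))^2))"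

text \<open>rho^ls_(m,v)(F, Phi_N, L2(Omega,mu)) for a given least squares selection
  LS xi J f = LS(xi, span{phi_j : j in J})(f).\<close>
definition rho_ls :: "'a set \<Rightarrow> 'a measure \<Rightarrow> nat \<Rightarrow> nat \<Rightarrow> nat \<Rightarrow> ('a \<Rightarrow> complex) set
     \<Rightarrow> ((nat \<Rightarrow> 'a) \<Rightarrow> nat set \<Rightarrow> ('a \<Rightarrow> complex) \<Rightarrow> ('a \<Rightarrow> complex)) \<Rightarrow> ennreal" where
  "rho_ls \<Omega> M m v N F LS = (INF \<xi>\<in>points \<Omega> m. SUP f\<in>F. INF J\<in>subsets_v N v.
       ennreal (L2norm M (\<lambda>x. f x - LS \<xi> J f x)))"

text \<open>F is a compact subset of C(Omega) (uniform metric), stated as sequential compactness.\<close>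
definition compact_C :: "('a::topological_space) set \<Rightarrow> ('a \<Rightarrow> complex) set \<Rightarrow> bool" where
  "compact_C \<Omega> F \<longleftrightarrow> (\<forall>f\<in>F. continuous_on \<Omega> f) \<and>
     (\<forall>s::nat \<Rightarrow> 'a \<Rightarrow> complex. range s \<subseteq> F \<longrightarrow>
        (\<exists>f\<in>F. \<exists>r. strict_mono r \<and> uniform_limit \<Omega> (\<lambda>n. s (r n)) f sequentially))"

end

(*
  It suffices to find points \<xi> with ||u||_2^2 <= 16 ||u||_\<xi>^2 for all v-sparse u: for g in the span L,
  the difference g - LS(\<xi>, L)(f) is v-sparse and is the orthogonal projection of g - f in the discrete
  seminorm, so ||f - LS f||_2^2 <= 5 ||f - g||_2^2 + 20 ||f - g||_\<xi>^2.

  Such points are found level by level (in the spirit of Haviv and Regev). For ||u||_2 = 1 one has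
  |u|^2 <= K v, and |u|^2 is comparable to the sum of T 1_{|u|^2 > T} over O(log(2v)) dyadic levels T.
  At level T, Maurey's empirical method replaces u by an average of O(K v log(2v) / T) dictionary
  functions, up to an error of order sqrt T off a set of small measure with respect to both \<mu> and
  the sample. There are only exp(O(K v log(2v) log N / T)) such averages, few enough for a union of
  Chernoff bounds comparing \<mu> with the sample on their level sets. Only a lower bound on the sample
  is needed. Both probabilistic steps are carried out by the method of conditional expectations.
*)
theory Submission
  imports Defs
begin


section \<open>Dyadic layer sums\<close>

text \<open>A dyadic layer-cake bound: raising the truncation height from \<open>T L\<close> to
  \<open>2 * T L\<close> raises the truncated value by at most \<open>T L\<close>, and only if
  \<open>y > T L\<close>.\<close>

lemma le_layer_sum:
  fixes y :: real and T :: "nat \<Rightarrow> real"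
  assumes T: "\<And>i. T (Suc i) = 2 * T i" "\<And>i. T i > 0"
  shows "min y (T L) \<le> T 0 + (\<Sum>i<L. T i * of_bool (y > T i))"
proof (induction L)
  case 0
  then show ?case by simp
next
  case (Suc L)
  have "min y (T (Suc L)) \<le> min y (T L) + T L * of_bool (y > T L)"
    using T(2)[of L] by (auto simp: T(1) min_def)
  with Suc show ?case by simp
qed

text \<open>The levels below \<open>y\<close> form a geometric progression, whose sum is at most
  twice its largest term.\<close>

lemma layer_sum_le:
  fixes y :: real and T :: "nat \<Rightarrow> real"
  assumes T: "\<And>i. T (Suc i) = 2 * T i" "\<And>i. T i > 0" and "y \<ge> 0"
  shows "(\<Sum>i<L. T i * of_bool (y > T i)) \<le> 2 * y"
proof (induction L)
  case 0
  then show ?case using assms by simp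
next
  case (Suc L)
  have *: "(\<Sum>i<n. T i) \<le> T n" for n
    by (induction n) (use T in \<open>auto simp: less_imp_le\<close>)
  show ?case
  proof (cases "y > T L")
    case True
    have "(\<Sum>i<Suc L. T i * of_bool (y > T i)) \<le> (\<Sum>i<Suc L. T i)"
      by (rule sum_mono) (use T in \<open>auto simp: less_imp_le\<close>)
    also have "\<dots> \<le> 2 * T L" using *[of "Suc L"] by (simp add: T)
    finally show ?thesis using True by linarith
  qed (use Suc in simp)
qed

section \<open>Choice of sample points by conditional expectations\<close>

lemma (in prob_space) exists_le_expectation:
  fixes g :: "'a \<Rightarrow> real"
  assumes "integrable M g" "expectation g \<le> c"
  shows "\<exists>x\<in>space M. g x \<le> c"
proof (rule ccontr)
  assume "\<not> ?thesis"
  then have "AE x in M. c < g x" by (auto simp: not_le)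
  from expectation_greater[OF assms(1) this] assms(2) show False by simp
qed

lemma exists_le_weighted_sum:
  fixes p y :: "'i \<Rightarrow> real"
  assumes "finite I" "\<And>i. i \<in> I \<Longrightarrow> p i \<ge> 0" "sum p I = 1" "(\<Sum>i\<in>I. p i * y i) \<le> c"
  shows "\<exists>i\<in>I. y i \<le> c"
proof (rule ccontr)
  assume "\<not> ?thesis"
  then have *: "y i > c" if "i \<in> I" for i using that by force
  obtain i where i: "i \<in> I" "p i > 0"
    using assms(2,3) by (metis less_eq_real_def sum.neutral zero_neq_one)
  have "(\<Sum>i\<in>I. p i * c) < (\<Sum>i\<in>I. p i * y i)"
    by (rule sum_strict_mono_ex1)
       (use assms(1,2) * i in \<open>auto intro!: mult_left_mono bexI[of _ i] simp: less_imp_le\<close>)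
  then show False using assms(3,4) by (simp flip: sum_distrib_right)
qed

text \<open>The method of conditional expectations for independent samples: one step multiplies the
  average weight of the \<open>i\<close>-th set by \<open>1 - (1 - exp (- 1)) * \<mu>(A i) \<le> exp (- \<mu>(A i) / 2)\<close>.\<close>
lemma (in prob_space) exists_points_exp_sum_le:
  fixes w :: "'i \<Rightarrow> real"
  assumes "finite I" "\<And>i. i \<in> I \<Longrightarrow> A i \<in> events" "\<And>i. i \<in> I \<Longrightarrow> w i \<ge> 0"
  shows "\<exists>\<xi>::nat \<Rightarrow> 'a. (\<forall>j. \<xi> j \<in> space M) \<and>
    (\<Sum>i\<in>I. w i * exp (- (\<Sum>j<m. indicator (A i) (\<xi> j)))) \<le>
    (\<Sum>i\<in>I. w i * exp (- (real m * prob (A i) / 2)))"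
  using assms(3)
proof (induction m arbitrary: w)
  case 0
  obtain x where "x \<in> space M" using not_empty by blast
  then show ?case by (intro exI[of _ "\<lambda>_. x"]) simp
next
  case (Suc m)
  \<comment> \<open>The factor that the last point will contribute is charged to the weights in
    advance, so the induction hypothesis for \<open>m\<close> points already produces the bound for
    \<open>Suc m\<close>.\<close>
  define w' where "w' i = w i * exp (- prob (A i) / 2)" for i
  have w'0: "\<And>i. i \<in> I \<Longrightarrow> w' i \<ge> 0" using Suc.prems by (simp add: w'_def)
  obtain \<xi> :: "nat \<Rightarrow> 'a" where \<xi>: "\<And>j. \<xi> j \<in> space M"
    and le: "(\<Sum>i\<in>I. w' i * exp (- (\<Sum>j<m. indicator (A i) (\<xi> j)))) \<le>
      (\<Sum>i\<in>I. w' i * exp (- (real m * prob (A i) / 2)))"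
    using Suc.IH[of w'] w'0 by auto
  define e where "e i = exp (- (\<Sum>j<m. indicator (A i) (\<xi> j)) :: real)" for i
  \<comment> \<open>\<open>g x\<close> is the weighted sum after \<open>x\<close> is appended as a
    further point: since an indicator is 0 or 1, \<open>exp (- indicator)\<close> is this affine
    expression, whose expectation only involves \<open>prob (A i)\<close>.\<close>
  define g where "g x = (\<Sum>i\<in>I. w i * e i * (1 - (1 - exp (- 1)) * indicator (A i) x))" for x
  have int: "integrable M (\<lambda>x. w i * e i * (1 - (1 - exp (- 1)) * indicator (A i) x))" if "i \<in> I" for i
    using assms(2)[OF that] by (auto intro!: integrable_real_indicator emeasure_finite simp: less_top[symmetric])
  have 1: "expectation (\<lambda>x. w i * e i * (1 - (1 - exp (- 1)) * indicator (A i) x)) \<le> w' i * e i"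
    if "i \<in> I" for i
  proof -
    have ind: "integrable M (indicator (A i) :: _ \<Rightarrow> real)"
      using assms(2)[OF that] by (auto intro!: integrable_real_indicator emeasure_finite simp: less_top[symmetric])
    have "expectation (\<lambda>x. w i * e i * (1 - (1 - exp (- 1)) * indicator (A i) x)) =
        w i * e i * (1 - (1 - exp (- 1)) * prob (A i))"
      using ind assms(2)[OF that] by (simp add: prob_space)
    also have "\<dots> \<le> w i * e i * exp (- prob (A i) / 2)"
    proof (rule mult_left_mono)
      have "exp (1::real) \<ge> 2" using exp_ge_add_one_self[of "1::real"] by simp
      then have "exp (- 1 :: real) \<le> 1 / 2" by (simp add: exp_minus field_simps)
      then have "(1 - exp (- 1)) * prob (A i) \<ge> (1 / 2) * prob (A i)"
        by (intro mult_right_mono) auto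
      then show "1 - (1 - exp (- 1)) * prob (A i) \<le> exp (- prob (A i) / 2)"
        using exp_ge_add_one_self[of "- prob (A i) / 2"] by linarith
    qed (use Suc.prems that in \<open>auto simp: e_def\<close>)
    finally show ?thesis by (simp add: w'_def mult_ac)
  qed
  have "expectation g = (\<Sum>i\<in>I. expectation (\<lambda>x. w i * e i * (1 - (1 - exp (- 1)) * indicator (A i) x)))"
    unfolding g_def by (rule Bochner_Integration.integral_sum) (rule int)
  also have "\<dots> \<le> (\<Sum>i\<in>I. w' i * e i)" by (rule sum_mono) (rule 1)
  finally have "expectation g \<le> (\<Sum>i\<in>I. w' i * e i)" .
  moreover have "integrable M g" unfolding g_def by (rule Bochner_Integration.integrable_sum) (rule int)
  ultimately obtain x where x: "x \<in> space M" "g x \<le> (\<Sum>i\<in>I. w' i * e i)"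
    using exists_le_expectation by blast
  let ?\<xi> = "\<xi>(m := x)"
  have "(\<Sum>i\<in>I. w i * exp (- (\<Sum>j<Suc m. indicator (A i) (?\<xi> j)))) = g x"
    unfolding g_def
  proof (rule sum.cong)
    fix i
    have "(\<Sum>j<m. indicator (A i) (?\<xi> j) :: real) = (\<Sum>j<m. indicator (A i) (\<xi> j))"
      by (rule sum.cong) auto
    then show "w i * exp (- (\<Sum>j<Suc m. indicator (A i) (?\<xi> j))) =
      w i * e i * (1 - (1 - exp (- 1)) * indicator (A i) x)"
      by (auto simp: e_def exp_diff exp_minus indicator_def divide_simps)
  qed simp
  also have "g x \<le> (\<Sum>i\<in>I. w' i * exp (- (real m * prob (A i) / 2)))"
    using x(2) le by (simp add: e_def)
  also have "\<dots> = (\<Sum>i\<in>I. w i * exp (- (real (Suc m) * prob (A i) / 2)))"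
    by (rule sum.cong) (auto simp: w'_def mult.assoc exp_add[symmetric] field_simps simp del: exp_add)
  finally show ?case using x(1) \<xi> by (intro exI[of _ ?\<xi>]) auto
qed

text \<open>A one-sided Chernoff estimate with a union bound. If the exponential sum is below 1,
  then so is each of its terms, and taking logarithms bounds each probability separately.\<close>

lemma (in prob_space) exists_points_prob_le:
  assumes "finite I" "\<And>i. i \<in> I \<Longrightarrow> A i \<in> events" "m \<ge> 1"
    and sum: "(\<Sum>i\<in>I. exp (- (real m * \<delta> i / 2))) < 1"
  shows "\<exists>\<xi>::nat \<Rightarrow> 'a. (\<forall>j. \<xi> j \<in> space M) \<and>
    (\<forall>i\<in>I. prob (A i) \<le> 2 * (\<Sum>j<m. indicator (A i) (\<xi> j)) / real m + \<delta> i)"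
proof -
  \<comment> \<open>With this normalization a term is below 1 exactly when half of
    \<open>m * (prob (A i) - \<delta> i)\<close> is below the number of hits of \<open>A i\<close>,
    and the averaged sum becomes the one assumed to be below 1.\<close>
  define w where "w i = exp (real m * (prob (A i) - \<delta> i) / 2)" for i
  obtain \<xi> where \<xi>: "\<And>j. \<xi> j \<in> space M" and le:
    "(\<Sum>i\<in>I. w i * exp (- (\<Sum>j<m. indicator (A i) (\<xi> j)))) \<le>
      (\<Sum>i\<in>I. w i * exp (- (real m * prob (A i) / 2)))"
    using exists_points_exp_sum_le[where I = I and A = A and w = w and m = m] assms(1,2)
    by (auto simp: w_def)
  have "(\<Sum>i\<in>I. w i * exp (- (real m * prob (A i) / 2))) = (\<Sum>i\<in>I. exp (- (real m * \<delta> i / 2)))"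
    by (rule sum.cong) (auto simp: w_def exp_add[symmetric] field_simps simp del: exp_add)
  with le sum have lt: "(\<Sum>i\<in>I. w i * exp (- (\<Sum>j<m. indicator (A i) (\<xi> j)))) < 1" by simp
  have "prob (A i) \<le> 2 * (\<Sum>j<m. indicator (A i) (\<xi> j)) / real m + \<delta> i" if "i \<in> I" for i
  proof -
    have "w i * exp (- (\<Sum>j<m. indicator (A i) (\<xi> j))) \<le>
        (\<Sum>i\<in>I. w i * exp (- (\<Sum>j<m. indicator (A i) (\<xi> j))))"
      by (rule member_le_sum) (use assms(1) that in \<open>auto simp: w_def\<close>)
    also note lt
    finally have "exp (real m * (prob (A i) - \<delta> i) / 2 + - (\<Sum>j<m. indicator (A i) (\<xi> j))) < 1"
      unfolding w_def exp_add .
    then have "real m * (prob (A i) - \<delta> i) / 2 < (\<Sum>j<m. indicator (A i) (\<xi> j))"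
      by simp
    then show ?thesis using assms(3) by (simp add: field_simps)
  qed
  with \<xi> show ?thesis by blast
qed


section \<open>Maurey's empirical method for complex-valued functions\<close>

lemma exp_le_quadratic:
  fixes y :: real
  assumes "\<bar>y\<bar> \<le> 1"
  shows "exp y \<le> 1 + y + y\<^sup>2"
proof (cases "y \<ge> 0")
  case True
  then show ?thesis using exp_bound[of y] assms by simp
next
  case False
  define z where "z = - y"
  have z: "0 \<le> z" "z \<le> 1" using False assms by (auto simp: z_def)
  \<comment> \<open>For negative \<open>y\<close> the claim amounts to
    \<open>1 \<le> (1 - z + z\<^sup>2) * exp z\<close>, and the quadratic Taylor polynomial of
    \<open>exp z\<close> is already enough.\<close>
  have "1 \<le> (1 - z + z\<^sup>2) * (1 + z + z\<^sup>2 / 2)"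
  proof -
    have "(1 - z + z\<^sup>2) * (1 + z + z\<^sup>2 / 2) = 1 + (z^2 + z^3 + z^4) / 2"
      by (simp add: power2_eq_square power3_eq_cube power4_eq_xxxx field_simps)
    then show ?thesis using z by simp
  qed
  also have "\<dots> \<le> (1 - z + z\<^sup>2) * exp z"
    by (intro mult_left_mono exp_lower_Taylor_quadratic) (use z in auto)
  finally show ?thesis by (simp add: z_def exp_minus divide_simps mult_ac)
qed

text \<open>The sub-Gaussian moment bound: the arguments \<open>\<theta> * X i\<close> stay in
  [-1, 1], where the exponential lies below \<open>1 + y + y\<^sup>2\<close>, and the linear term
  averages to zero.\<close>

lemma weighted_exp_sum_le:
  fixes p X :: "'i \<Rightarrow> real"
  assumes "\<And>i. i \<in> I \<Longrightarrow> p i \<ge> 0" "sum p I = 1" "\<And>i. i \<in> I \<Longrightarrow> \<bar>X i\<bar> \<le> 2"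
    and mean: "(\<Sum>i\<in>I. p i * X i) = 0" and "0 \<le> \<theta>" "\<theta> \<le> 1 / 2"
  shows "(\<Sum>i\<in>I. p i * exp (\<theta> * X i)) \<le> exp (4 * \<theta>\<^sup>2)"
proof -
  have "(\<Sum>i\<in>I. p i * exp (\<theta> * X i)) \<le> (\<Sum>i\<in>I. p i * (1 + \<theta> * X i + 4 * \<theta>\<^sup>2))"
  proof (intro sum_mono mult_left_mono)
    fix i assume i: "i \<in> I"
    have "\<bar>\<theta> * X i\<bar> \<le> 1 / 2 * 2"
      unfolding abs_mult using assms(3)[OF i] assms(5,6) by (intro mult_mono) auto
    then have "exp (\<theta> * X i) \<le> 1 + \<theta> * X i + (\<theta> * X i)\<^sup>2" by (intro exp_le_quadratic) simp
    moreover have "(X i)\<^sup>2 \<le> 2\<^sup>2" using assms(3)[OF i] by (metis abs_le_square_iff abs_numeral)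
    then have "(\<theta> * X i)\<^sup>2 \<le> 4 * \<theta>\<^sup>2"
      using mult_left_mono[of "(X i)\<^sup>2" 4 "\<theta>\<^sup>2"] by (simp add: power_mult_distrib mult.commute)
    ultimately show "exp (\<theta> * X i) \<le> 1 + \<theta> * X i + 4 * \<theta>\<^sup>2" by linarith
  qed (use assms in auto)
  also have "\<dots> = (\<Sum>i\<in>I. p i) * (1 + 4 * \<theta>\<^sup>2) + \<theta> * (\<Sum>i\<in>I. p i * X i)"
    unfolding sum_distrib_left sum_distrib_right sum.distrib[symmetric]
    by (intro sum.cong) (auto simp: algebra_simps)
  also have "\<dots> \<le> exp (4 * \<theta>\<^sup>2)"
    using assms(2) mean exp_ge_add_one_self[of "4 * \<theta>\<^sup>2"] by simp
  finally show ?thesis .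
qed

text \<open>Twice the integral with respect to the measure \<open>\<mu>\<^sub>\<xi>\<close>.\<close>
definition mixed_integral :: "'a measure \<Rightarrow> (nat \<Rightarrow> 'a) \<Rightarrow> nat \<Rightarrow> ('a \<Rightarrow> real) \<Rightarrow> real" where
  "mixed_integral M \<xi> m g = (\<integral>x. g x \<partial>M) + (\<Sum>j<m. g (\<xi> j)) / real m"

lemma mixed_integral_mono:
  assumes "integrable M f" "integrable M g" "\<And>x. x \<in> space M \<Longrightarrow> f x \<le> g x" "\<And>j. \<xi> j \<in> space M"
  shows "mixed_integral M \<xi> m f \<le> mixed_integral M \<xi> m g"
  unfolding mixed_integral_def using assms
  by (intro add_mono integral_mono divide_right_mono sum_mono) auto

lemma mixed_integral_sum:
  assumes "\<And>i. i \<in> I \<Longrightarrow> integrable M (g i)"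
  shows "mixed_integral M \<xi> m (\<lambda>x. \<Sum>i\<in>I. g i x) = (\<Sum>i\<in>I. mixed_integral M \<xi> m (g i))"
  using assms unfolding mixed_integral_def
  by (simp add: sum.distrib sum_divide_distrib[symmetric] sum.swap[of _ I])

lemma mixed_integral_mult:
  "mixed_integral M \<xi> m (\<lambda>x. c * g x) = c * mixed_integral M \<xi> m g"
  unfolding mixed_integral_def by (simp add: sum_distrib_left distrib_left)

lemma (in prob_space) mixed_integral_const:
  "m \<ge> 1 \<Longrightarrow> mixed_integral M \<xi> m (\<lambda>_. c) = 2 * c"
  unfolding mixed_integral_def by (simp add: prob_space)

text \<open>Testing against four unit directions turns the modulus of a complex number into real
  linear functionals, to which exponential moments apply.\<close>

definition directions :: "complex set" where
  "directions = {1, -1, \<i>, -\<i>}"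

lemma card_directions: "finite directions" "card directions = 4"
  by (auto simp: directions_def complex_eq_iff card_insert_if)

lemma norm_directions: "d \<in> directions \<Longrightarrow> cmod d = 1"
  by (auto simp: directions_def)

text \<open>The largest of the four values of \<open>Re (d * z)\<close> is the larger of |Re z| and
  |Im z|, hence at least half of their sum.\<close>

lemma exists_direction_Re_ge: "\<exists>d\<in>directions. cmod z \<le> 2 * Re (d * z)"
  using cmod_le[of z] unfolding directions_def by (auto simp: abs_if split: if_splits)

text \<open>The setting for drawing indices with probabilities \<open>p\<close> and replacing a
  convex combination of the \<open>\<psi> i\<close> by an empirical average. The sample
  \<open>\<xi>\<close> is fixed beforehand, so that the average can be made accurate on the sample
  as well as for \<open>M\<close>.\<close>

locale sparse_approx = prob_space M for M :: "'a measure" +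
  fixes I :: "'i set" and \<psi> :: "'i \<Rightarrow> 'a \<Rightarrow> complex" and p :: "'i \<Rightarrow> real"
    and \<xi> :: "nat \<Rightarrow> 'a" and m :: nat
  assumes fin: "finite I" and meas: "\<And>i. i \<in> I \<Longrightarrow> \<psi> i \<in> borel_measurable M"
    and bound: "\<And>i x. i \<in> I \<Longrightarrow> x \<in> space M \<Longrightarrow> cmod (\<psi> i x) \<le> 1"
    and p: "\<And>i. i \<in> I \<Longrightarrow> p i \<ge> 0" "sum p I = 1"
    and \<xi>: "\<And>j. \<xi> j \<in> space M" and m: "m \<ge> 1"
begin

definition mean :: "'a \<Rightarrow> complex" where
  "mean x = (\<Sum>i\<in>I. of_real (p i) * \<psi> i x)"

definition deviation :: "'i list \<Rightarrow> 'a \<Rightarrow> complex" where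
  "deviation xs x = (\<Sum>i\<leftarrow>xs. \<psi> i x - mean x)"

text \<open>An exponential majorant for large deviations: for nonnegative \<open>\<theta>\<close>,
  wherever the deviation has modulus at least \<open>s\<close>, one of the four terms is at least
  \<open>exp (\<theta> * s / 2)\<close>.\<close>

definition potential :: "real \<Rightarrow> 'i list \<Rightarrow> 'a \<Rightarrow> real" where
  "potential \<theta> xs x = (\<Sum>d\<in>directions. exp (\<theta> * Re (d * deviation xs x)))"

lemma mean_measurable [measurable]: "mean \<in> borel_measurable M"
  unfolding mean_def using meas by measurable

lemma norm_mean: "x \<in> space M \<Longrightarrow> cmod (mean x) \<le> 1"
proof -
  assume x: "x \<in> space M"
  have "cmod (mean x) \<le> (\<Sum>i\<in>I. p i * 1)"
    unfolding mean_def using p(1) bound[OF _ x]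
    by (intro sum_norm_le) (auto simp: norm_mult intro!: mult_left_le)
  then show ?thesis using p(2) by simp
qed

lemma norm_diff_mean: "i \<in> I \<Longrightarrow> x \<in> space M \<Longrightarrow> cmod (\<psi> i x - mean x) \<le> 2"
  using norm_triangle_ineq4[of "\<psi> i x" "mean x"] bound norm_mean by fastforce

lemma deviation_measurable:
  "set xs \<subseteq> I \<Longrightarrow> deviation xs \<in> borel_measurable M"
proof (induction xs)
  case (Cons i xs)
  then have [measurable]: "\<psi> i \<in> borel_measurable M" "deviation xs \<in> borel_measurable M"
    using meas by auto
  have "deviation (i # xs) = (\<lambda>x. (\<psi> i x - mean x) + deviation xs x)"
    by (auto simp: deviation_def)
  then show ?case by simp
qed (simp add: deviation_def[abs_def])

lemma norm_deviation:
  "set xs \<subseteq> I \<Longrightarrow> x \<in> space M \<Longrightarrow> cmod (deviation xs x) \<le> 2 * length xs"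
proof (induction xs)
  case (Cons i xs)
  then have "cmod (\<psi> i x - mean x) \<le> 2" "cmod (deviation xs x) \<le> 2 * length xs"
    using norm_diff_mean by auto
  then show ?case
    using norm_triangle_ineq[of "\<psi> i x - mean x" "deviation xs x"] by (simp add: deviation_def)
qed (simp add: deviation_def)

lemma integrable_potential:
  assumes xs: "set xs \<subseteq> I" and "\<theta> \<ge> 0"
  shows "integrable M (potential \<theta> xs)"
proof (rule integrable_const_bound)
  note [measurable] = deviation_measurable[OF xs]
  show "potential \<theta> xs \<in> borel_measurable M"
    unfolding potential_def by measurable
  show "AE x in M. norm (potential \<theta> xs x) \<le> 4 * exp (\<theta> * (2 * length xs))"
  proof (rule AE_I2)
    fix x assume x: "x \<in> space M"
    have "Re (d * deviation xs x) \<le> 2 * length xs" if "d \<in> directions" for d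
      using complex_Re_le_cmod[of "d * deviation xs x"] norm_deviation[OF xs x]
      by (simp add: norm_mult norm_directions[OF that])
    then have "potential \<theta> xs x \<le> (\<Sum>d\<in>directions. exp (\<theta> * (2 * length xs)))"
      unfolding potential_def using assms(2) by (intro sum_mono) (auto intro!: mult_left_mono)
    moreover have "potential \<theta> xs x \<ge> 0"
      unfolding potential_def by (intro sum_nonneg) simp
    ultimately show "norm (potential \<theta> xs x) \<le> 4 * exp (\<theta> * (2 * length xs))"
      by (simp add: card_directions)
  qed
qed

text \<open>Drawing one more index adds a centred increment to the deviation, so each exponential
  splits into the old factor and a new one, whose average is controlled by the moment bound.\<close>

lemma weighted_potential_le:
  assumes xs: "set xs \<subseteq> I" and \<theta>: "0 \<le> \<theta>" "\<theta> \<le> 1 / 2" and x: "x \<in> space M"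
  shows "(\<Sum>i\<in>I. p i * potential \<theta> (i # xs) x) \<le> exp (4 * \<theta>\<^sup>2) * potential \<theta> xs x"
proof -
  have "(\<Sum>i\<in>I. p i * potential \<theta> (i # xs) x) =
      (\<Sum>d\<in>directions. exp (\<theta> * Re (d * deviation xs x)) *
        (\<Sum>i\<in>I. p i * exp (\<theta> * Re (d * (\<psi> i x - mean x)))))"
    unfolding potential_def sum_distrib_left
    by (subst sum.swap) (intro sum.cong refl, simp add: deviation_def ring_distribs exp_add mult_ac)
  also have "\<dots> \<le> (\<Sum>d\<in>directions. exp (\<theta> * Re (d * deviation xs x)) * exp (4 * \<theta>\<^sup>2))"
  proof (intro sum_mono mult_left_mono weighted_exp_sum_le)
    fix d assume d: "d \<in> directions"
    show "\<bar>Re (d * (\<psi> i x - mean x))\<bar> \<le> 2" if "i \<in> I" for i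
      using abs_Re_le_cmod[of "d * (\<psi> i x - mean x)"] norm_diff_mean[OF that x]
      by (simp add: norm_mult norm_directions[OF d])
    have "(\<Sum>i\<in>I. of_real (p i) * (d * (\<psi> i x - mean x))) = 0"
    proof -
      have "(\<Sum>i\<in>I. of_real (p i) * (d * (\<psi> i x - mean x))) =
          d * (mean x - of_real (sum p I) * mean x)"
        unfolding mean_def of_real_sum sum_distrib_right sum_subtractf[symmetric]
        by (subst sum_distrib_left) (auto intro!: sum.cong simp: algebra_simps)
      then show ?thesis using p(2) by simp
    qed
    then have "Re (\<Sum>i\<in>I. of_real (p i) * (d * (\<psi> i x - mean x))) = 0" by (simp only: zero_complex.simps)
    then show "(\<Sum>i\<in>I. p i * Re (d * (\<psi> i x - mean x))) = 0"
      by (simp only: Re_sum scaleR_conv_of_real[symmetric] scaleR_complex.simps)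
  qed (use p \<theta> in auto)
  also have "\<dots> = exp (4 * \<theta>\<^sup>2) * potential \<theta> xs x"
    by (simp add: potential_def sum_distrib_left mult.commute)
  finally show ?thesis .
qed

text \<open>Indices are added one at a time, each with a potential no larger than its weighted
  average. The factor 8 is the number of directions times the total mass 2 of the mixed
  integral.\<close>

lemma exists_potential_le:
  assumes \<theta>: "0 \<le> \<theta>" "\<theta> \<le> 1 / 2"
  shows "\<exists>xs. set xs \<subseteq> I \<and> length xs = n \<and>
    mixed_integral M \<xi> m (potential \<theta> xs) \<le> 8 * exp (4 * \<theta>\<^sup>2) ^ n"
proof (induction n)
  case 0
  have "potential \<theta> [] = (\<lambda>_. 4)"
    by (auto simp: potential_def deviation_def card_directions)
  then show ?case using mixed_integral_const[OF m] by (intro exI[of _ "[]"]) simp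
next
  case (Suc n)
  then obtain xs where xs: "set xs \<subseteq> I" "length xs = n"
    and le: "mixed_integral M \<xi> m (potential \<theta> xs) \<le> 8 * exp (4 * \<theta>\<^sup>2) ^ n" by blast
  have int: "integrable M (\<lambda>x. p i * potential \<theta> (i # xs) x)" if "i \<in> I" for i
    using integrable_potential[of "i # xs"] xs that \<theta> by simp
  have "(\<Sum>i\<in>I. p i * mixed_integral M \<xi> m (potential \<theta> (i # xs))) =
      mixed_integral M \<xi> m (\<lambda>x. \<Sum>i\<in>I. p i * potential \<theta> (i # xs) x)"
    using int by (subst mixed_integral_sum) (auto simp: mixed_integral_mult)
  also have "\<dots> \<le> mixed_integral M \<xi> m (\<lambda>x. exp (4 * \<theta>\<^sup>2) * potential \<theta> xs x)"
    using int weighted_potential_le[OF xs(1) \<theta>] \<xi> integrable_potential[OF xs(1) \<theta>(1)]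
    by (intro mixed_integral_mono Bochner_Integration.integrable_sum integrable_mult_right) auto
  also have "\<dots> \<le> 8 * exp (4 * \<theta>\<^sup>2) ^ Suc n"
    using le by (simp add: mixed_integral_mult)
  finally have avg: "(\<Sum>i\<in>I. p i * mixed_integral M \<xi> m (potential \<theta> (i # xs))) \<le> 8 * exp (4 * \<theta>\<^sup>2) ^ Suc n" .
  obtain i where "i \<in> I"
    "mixed_integral M \<xi> m (potential \<theta> (i # xs)) \<le> 8 * exp (4 * \<theta>\<^sup>2) ^ Suc n"
    by (rule bexE[OF exists_le_weighted_sum[where y = "\<lambda>i. mixed_integral M \<xi> m (potential \<theta> (i # xs))", OF fin p(1,2) avg]])
  then show ?case using xs by (intro exI[of _ "i # xs"]) auto
qed

text \<open>Markov's inequality applied to the potential, for both the measure and the sample: a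
  deviation beyond \<open>n * \<tau>\<close> forces some direction beyond
  \<open>n * \<tau> / 2\<close>.\<close>

lemma exists_sampled_mean:
  assumes n: "n \<ge> 1" and \<tau>: "0 < \<tau>" "\<tau> \<le> 1"
  shows "\<exists>xs. set xs \<subseteq> I \<and> length xs = n \<and>
    mixed_integral M \<xi> m (indicator {x \<in> space M. cmod (mean x - (\<Sum>i\<leftarrow>xs. \<psi> i x) / n) > \<tau>})
      \<le> 8 * exp (- (n * \<tau>\<^sup>2 / 64))"
proof -
  \<comment> \<open>The minimizer of the exponent
    \<open>4 * \<theta>\<^sup>2 - \<theta> * \<tau> / 2\<close> per draw; the minimum is
    \<open>- \<tau>\<^sup>2 / 64\<close>.\<close>
  define \<theta> where "\<theta> = \<tau> / 16"
  have \<theta>: "0 \<le> \<theta>" "\<theta> \<le> 1 / 2" using \<tau> by (auto simp: \<theta>_def)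
  obtain xs where xs: "set xs \<subseteq> I" "length xs = n"
    and le: "mixed_integral M \<xi> m (potential \<theta> xs) \<le> 8 * exp (4 * \<theta>\<^sup>2) ^ n"
    using exists_potential_le[OF \<theta>] by blast
  note [measurable] = deviation_measurable[OF xs(1)]
  have dev: "deviation xs x = (\<Sum>i\<leftarrow>xs. \<psi> i x) - n * mean x" for x
    unfolding deviation_def xs(2)[symmetric] by (induction xs) (auto simp: algebra_simps)
  have norm: "cmod (mean x - (\<Sum>i\<leftarrow>xs. \<psi> i x) / n) = cmod (deviation xs x) / n" for x
  proof -
    have "mean x - (\<Sum>i\<leftarrow>xs. \<psi> i x) / n = - (deviation xs x / n)"
      using n by (simp add: dev field_simps)
    then show ?thesis by (simp add: norm_divide)
  qed
  let ?c = "exp (- (\<theta> * (n * \<tau> / 2)))"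
  have "mixed_integral M \<xi> m (indicator {x \<in> space M. cmod (mean x - (\<Sum>i\<leftarrow>xs. \<psi> i x) / n) > \<tau>})
      \<le> mixed_integral M \<xi> m (\<lambda>x. ?c * potential \<theta> xs x)"
  proof (rule mixed_integral_mono)
    fix x assume x: "x \<in> space M"
    show "indicator {x \<in> space M. cmod (mean x - (\<Sum>i\<leftarrow>xs. \<psi> i x) / n) > \<tau>} x \<le> ?c * potential \<theta> xs x"
    proof (cases "cmod (deviation xs x) / n > \<tau>")
      case True
      obtain d where d: "d \<in> directions" "cmod (deviation xs x) \<le> 2 * Re (d * deviation xs x)"
        using exists_direction_Re_ge by blast
      have "\<theta> * (n * \<tau> / 2) \<le> \<theta> * Re (d * deviation xs x)"
        using True d(2) n \<theta>(1) by (intro mult_left_mono) (auto simp: field_simps)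
      then have "exp (\<theta> * (n * \<tau> / 2)) \<le> exp (\<theta> * Re (d * deviation xs x))" by simp
      also have "\<dots> \<le> potential \<theta> xs x"
        unfolding potential_def by (rule member_le_sum) (use d card_directions in auto)
      finally have "1 \<le> ?c * potential \<theta> xs x" by (simp add: exp_minus divide_simps mult_ac)
      then show ?thesis by (auto simp: indicator_def)
    next
      case False
      then show ?thesis unfolding norm potential_def
        by (intro order_trans[OF _ mult_nonneg_nonneg] sum_nonneg) auto
    qed
  next
    show "integrable M (indicator {x \<in> space M. cmod (mean x - (\<Sum>i\<leftarrow>xs. \<psi> i x) / n) > \<tau>} :: _ \<Rightarrow> real)"
      unfolding norm by (intro integrable_real_indicator) (auto simp: emeasure_finite less_top[symmetric])
  qed (use integrable_potential[OF xs(1) \<theta>(1)] \<xi> in auto)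
  also have "\<dots> \<le> ?c * (8 * exp (4 * \<theta>\<^sup>2) ^ n)"
    unfolding mixed_integral_mult by (intro mult_left_mono le) simp
  also have "\<dots> = 8 * exp (- (n * \<tau>\<^sup>2 / 64))"
    by (simp add: \<theta>_def power2_eq_square exp_of_nat_mult[symmetric] exp_add[symmetric] field_simps
        del: exp_of_nat_mult exp_add)
  finally show ?thesis using xs by blast
qed

end


section \<open>Sparse sums as convex combinations\<close>

lemma sum_directions:
  fixes f :: "complex \<Rightarrow> 'b::comm_monoid_add"
  shows "sum f (insert 0 directions) = f 0 + (f 1 + (f (-1) + (f \<i> + f (-\<i>))))"
proof -
  have "(1::complex) \<noteq> -1" "(1::complex) \<noteq> \<i>" "(1::complex) \<noteq> -\<i>" "-1 \<noteq> \<i>" "-1 \<noteq> -\<i>" "\<i> \<noteq> -\<i>"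
    by (auto simp: complex_eq_iff)
  then show ?thesis by (simp add: directions_def)
qed

text \<open>A coefficient is split into the positive and negative parts of its real and imaginary
  parts, each carried by one direction. The extra value 0 absorbs the missing mass, so that an upper
  bound \<open>R\<close> is enough.\<close>

lemma exists_convex_weights:
  fixes a :: "nat \<Rightarrow> complex"
  assumes "N \<ge> 1" "R > 0" and le: "(\<Sum>j=1..N. \<bar>Re (a j)\<bar> + \<bar>Im (a j)\<bar>) \<le> R"
  shows "\<exists>p. (\<forall>i\<in>{1..N} \<times> insert 0 directions. p i \<ge> 0) \<and> sum p ({1..N} \<times> insert 0 directions) = 1 \<and>
    (\<forall>y. (\<Sum>i\<in>{1..N} \<times> insert 0 directions. of_real (p i) * (snd i * y (fst i))) =
      (\<Sum>j=1..N. a j * y j) / R)"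
proof -
  define S where "S = (\<Sum>j=1..N. \<bar>Re (a j)\<bar> + \<bar>Im (a j)\<bar>)"
  \<comment> \<open>The slack \<open>1 - S / R\<close> is spread evenly over the \<open>N\<close>
    pairs with direction 0; \<open>Re (cnj d * a j)\<close> is the component of \<open>a j\<close>
    along \<open>d\<close>.\<close>
  define p where "p = (\<lambda>(j, d). if d = 0 then (1 - S / R) / N else max 0 (Re (cnj d * a j)) / R)"
  have "\<forall>i\<in>{1..N} \<times> insert 0 directions. p i \<ge> 0"
    using assms(2) le by (auto simp: p_def S_def)
  moreover have "sum p ({1..N} \<times> insert 0 directions) = 1"
  proof -
    have "sum p ({1..N} \<times> insert 0 directions) = (\<Sum>j=1..N. \<Sum>d\<in>insert 0 directions. p (j, d))"
      by (simp add: sum.cartesian_product)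
    also have "\<dots> = (\<Sum>j=1..N. (1 - S / R) / N + (\<bar>Re (a j)\<bar> + \<bar>Im (a j)\<bar>) / R)"
      unfolding sum_directions by (intro sum.cong refl) (auto simp: p_def max_def abs_if add_divide_distrib)
    also have "\<dots> = (\<Sum>j=1..N. (1 - S / R) / N) + S / R"
      unfolding S_def sum_divide_distrib by (rule sum.distrib)
    also have "\<dots> = 1" using assms(1) by simp
    finally show ?thesis .
  qed
  moreover have "(\<Sum>i\<in>{1..N} \<times> insert 0 directions. of_real (p i) * (snd i * y (fst i))) =
      (\<Sum>j=1..N. a j * y j) / R" for y :: "nat \<Rightarrow> complex"
  proof -
    have "(\<Sum>i\<in>{1..N} \<times> insert 0 directions. of_real (p i) * (snd i * y (fst i))) =
        (\<Sum>j=1..N. \<Sum>d\<in>insert 0 directions. of_real (p (j, d)) * (d * y j))"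
      by (simp add: sum.cartesian_product case_prod_beta)
    also have "\<dots> = (\<Sum>j=1..N. a j * y j / R)"
    proof (intro sum.cong refl)
      fix j
      have "(\<Sum>d\<in>insert 0 directions. of_real (p (j, d)) * d) = a j / R"
        unfolding sum_directions
        by (auto simp: p_def complex_eq_iff max_def)
      then show "(\<Sum>d\<in>insert 0 directions. of_real (p (j, d)) * (d * y j)) = a j * y j / R"
        by (simp add: mult.assoc[symmetric] sum_distrib_right[symmetric])
    qed
    finally show ?thesis by (simp add: sum_divide_distrib)
  qed
  ultimately show ?thesis by blast
qed

section \<open>From level sets to a norm inequality\<close>

text \<open>Off a small bad set, |u|^2 > T implies that |w| exceeds 7/8 of sqrt T, which in turn
  implies that |u| exceeds 3/4 of sqrt T. The first implication is used for the measure, the second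
  on the sample, and \<open>level\<close> links the two; summing over the levels recovers |u|^2 on
  both sides.\<close>

lemma (in prob_space) one_le_of_level_sets:
  fixes u :: "'a \<Rightarrow> complex" and w :: "nat \<Rightarrow> 'a \<Rightarrow> complex" and T :: "nat \<Rightarrow> real"
  assumes u [measurable]: "u \<in> borel_measurable M" and w: "\<And>i. i < L \<Longrightarrow> w i \<in> borel_measurable M"
    and T: "\<And>i. T i = 2 ^ i / 4"
    and bound: "\<And>x. x \<in> space M \<Longrightarrow> (cmod (u x))\<^sup>2 \<le> T L"
    and one: "(\<integral>x. (cmod (u x))\<^sup>2 \<partial>M) = 1"
    and \<xi>: "\<And>j. \<xi> j \<in> space M" and m: "m \<ge> 1"
    and bad: "\<And>i. i < L \<Longrightarrow> mixed_integral M \<xi> m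
      (indicator {x \<in> space M. cmod (u x - w i x) > sqrt (T i) / 8}) \<le> 1 / (16 * real L * T i)"
    and level: "\<And>i. i < L \<Longrightarrow> prob {x \<in> space M. cmod (w i x) > 7 / 8 * sqrt (T i)} \<le>
      2 * (\<Sum>j<m. indicator {x \<in> space M. cmod (w i x) > 7 / 8 * sqrt (T i)} (\<xi> j)) / real m + 1 / (8 * real L * T i)"
  shows "1 \<le> 16 * ((\<Sum>j<m. (cmod (u (\<xi> j)))\<^sup>2) / m)"
proof -
  define P where "P Q = (\<Sum>j<m. of_bool (Q (\<xi> j)) :: real) / m" for Q
  define X where "X i x \<longleftrightarrow> cmod (u x - w i x) > sqrt (T i) / 8" for i x
  define Y where "Y i x \<longleftrightarrow> cmod (w i x) > 7 / 8 * sqrt (T i)" for i x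
  define y where "y x = (cmod (u x))\<^sup>2" for x
  have Tpos: "T i > 0" and TSuc: "T (Suc i) = 2 * T i" for i by (auto simp: T)
  have meas [measurable]: "Measurable.pred M (X i)" "Measurable.pred M (Y i)" if "i < L" for i
    using w[OF that] unfolding X_def[abs_def] Y_def[abs_def] by measurable
  have ym [measurable]: "y \<in> borel_measurable M" unfolding y_def by measurable
  have int_ind: "integrable M (\<lambda>x. of_bool (Q x) :: real)" if "Measurable.pred M Q" for Q
    by (rule integrable_const_bound[of _ 1]) (use that in auto)
  have prob_eq: "(\<integral>x. of_bool (Q x) \<partial>M) = prob {x \<in> space M. Q x}" if "Measurable.pred M Q" for Q
  proof -
    have "(\<integral>x. of_bool (Q x) \<partial>M) = (\<integral>x. indicator {x \<in> space M. Q x} x \<partial>M :: real)"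
      by (rule Bochner_Integration.integral_cong) (auto simp: indicator_def)
    then show ?thesis using that by simp
  qed
  have P_ind: "(\<Sum>j<m. indicator {x \<in> space M. Q x} (\<xi> j)) / real m = P Q" for Q
    unfolding P_def using \<xi> by (simp add: indicator_def of_bool_def)
  have mixed: "prob {x \<in> space M. X i x} + P (X i) \<le> 1 / (16 * real L * T i)" if "i < L" for i
    using bad[OF that] meas(1)[OF that]
    unfolding mixed_integral_def X_def[symmetric] P_ind by simp
  have step: "T i * prob {x \<in> space M. y x > T i} \<le> 1 / (4 * real L) + 2 * (T i * P (\<lambda>x. 16 / 9 * y x > T i))"
    if i: "i < L" for i
  proof -
    note [measurable] = meas[OF i]
    have "prob {x \<in> space M. y x > T i} \<le> prob ({x \<in> space M. Y i x} \<union> {x \<in> space M. X i x})"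
    proof (rule finite_measure_mono)
      show "{x \<in> space M. y x > T i} \<subseteq> {x \<in> space M. Y i x} \<union> {x \<in> space M. X i x}"
      proof clarsimp
        fix x assume x: "y x > T i" "\<not> X i x"
        have "sqrt (T i) < cmod (u x)" using x(1) by (simp add: y_def real_less_lsqrt)
        with x(2) show "Y i x"
          using norm_triangle_sub[of "u x" "w i x"] by (auto simp: X_def Y_def)
      qed
    qed measurable
    also have "\<dots> \<le> prob {x \<in> space M. Y i x} + prob {x \<in> space M. X i x}"
      by (rule measure_Un_le) measurable
    also have "prob {x \<in> space M. Y i x} \<le> 2 * P (Y i) + 1 / (8 * real L * T i)"
      using level[OF i] unfolding Y_def[symmetric] P_ind[symmetric] by simp
    \<comment> \<open>On the sample the approximation is undone: 7/8 - 1/8 = 3/4, whose square is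
      9/16, hence the factor 16/9.\<close>
    also have "P (Y i) \<le> P (\<lambda>x. 16 / 9 * y x > T i) + P (X i)"
      unfolding P_def add_divide_distrib[symmetric] sum.distrib[symmetric]
    proof (intro divide_right_mono sum_mono)
      fix j
      have "16 / 9 * y x > T i" if "Y i x" "\<not> X i x" for x
      proof -
        have "3 / 4 * sqrt (T i) < cmod (u x)"
          using that norm_triangle_sub[of "w i x" "u x"] by (auto simp: X_def Y_def norm_minus_commute)
        then have "(3 / 4 * sqrt (T i))\<^sup>2 < (cmod (u x))\<^sup>2"
          using Tpos[of i] by (intro power_strict_mono) auto
        then show ?thesis using Tpos[of i] by (simp add: y_def power_mult_distrib power2_eq_square)
      qed
      then show "of_bool (Y i (\<xi> j)) \<le> (of_bool (T i < 16 / 9 * y (\<xi> j)) + of_bool (X i (\<xi> j)) :: real)"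
        by auto
    qed simp
    finally have "prob {x \<in> space M. y x > T i} \<le>
        2 * P (\<lambda>x. 16 / 9 * y x > T i) + (2 * P (X i) + prob {x \<in> space M. X i x}) + 1 / (8 * real L * T i)"
      by simp
    \<comment> \<open>The bad set enters once for the measure and, because of the factor 2 in
      \<open>level\<close>, twice for the sample.\<close>
    also have "2 * P (X i) + prob {x \<in> space M. X i x} \<le> 2 * (prob {x \<in> space M. X i x} + P (X i))"
      by simp
    also have "\<dots> \<le> 2 * (1 / (16 * real L * T i))" using mixed[OF i] by simp
    finally have "prob {x \<in> space M. y x > T i} \<le> 2 * P (\<lambda>x. 16 / 9 * y x > T i) + 1 / (4 * real L * T i)"
      by simp
    from mult_left_mono[OF this, of "T i"] Tpos[of i] show ?thesis
      by (simp add: algebra_simps)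
  qed
  have "1 = (\<integral>x. y x \<partial>M)" using one by (simp add: y_def)
  also have "\<dots> \<le> (\<integral>x. T 0 + (\<Sum>i<L. T i * of_bool (y x > T i)) \<partial>M)"
  proof (rule integral_mono)
    show "integrable M y"
      by (rule integrable_const_bound[of _ "T L"]) (use bound in \<open>auto simp: y_def\<close>)
    show "integrable M (\<lambda>x. T 0 + (\<Sum>i<L. T i * of_bool (y x > T i)))"
      by (intro Bochner_Integration.integrable_add Bochner_Integration.integrable_sum
          integrable_mult_right int_ind) auto
    show "y x \<le> T 0 + (\<Sum>i<L. T i * of_bool (y x > T i))" if "x \<in> space M" for x
      using le_layer_sum[of T "y x" L, OF TSuc Tpos] bound[OF that] by (simp add: y_def)
  qed
  also have "\<dots> = T 0 + (\<Sum>i<L. T i * prob {x \<in> space M. y x > T i})"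
  proof -
    have "(\<integral>x. T 0 + (\<Sum>i<L. T i * of_bool (y x > T i)) \<partial>M) =
        (\<integral>x. T 0 \<partial>M) + (\<integral>x. (\<Sum>i<L. T i * of_bool (y x > T i)) \<partial>M)"
      by (intro Bochner_Integration.integral_add Bochner_Integration.integrable_sum
          integrable_mult_right int_ind) auto
    also have "(\<integral>x. (\<Sum>i<L. T i * of_bool (y x > T i)) \<partial>M) = (\<Sum>i<L. \<integral>x. T i * of_bool (y x > T i) \<partial>M)"
      by (intro Bochner_Integration.integral_sum integrable_mult_right int_ind) auto
    also have "\<dots> = (\<Sum>i<L. T i * prob {x \<in> space M. y x > T i})"
      by (intro sum.cong refl) (simp add: prob_eq)
    finally show ?thesis by (simp add: prob_space)
  qed
  also have "\<dots> \<le> T 0 + (\<Sum>i<L. 1 / (4 * real L) + 2 * (T i * P (\<lambda>x. 16 / 9 * y x > T i)))"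
    by (intro add_left_mono sum_mono step) auto
  \<comment> \<open>The \<open>L\<close> level errors add up to at most 1/4, and \<open>T 0\<close>
    is 1/4, so half of the unit mass remains to be seen by the sample.\<close>
  also have "\<dots> \<le> 1 / 2 + 2 * (\<Sum>i<L. T i * P (\<lambda>x. 16 / 9 * y x > T i))"
    by (auto simp: sum.distrib sum_distrib_left T)
  \<comment> \<open>Exchanging the sums gives, at each sample point, a layer sum of
    \<open>16 / 9 * y\<close>, which is at most twice that value.\<close>
  also have "(\<Sum>i<L. T i * P (\<lambda>x. 16 / 9 * y x > T i)) =
      (\<Sum>j<m. \<Sum>i<L. T i * of_bool (16 / 9 * y (\<xi> j) > T i)) / m"
    unfolding P_def sum_distrib_left sum_divide_distrib times_divide_eq_right by (rule sum.swap)
  also have "\<dots> \<le> (\<Sum>j<m. 2 * (16 / 9 * y (\<xi> j))) / m"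
    by (intro divide_right_mono sum_mono layer_sum_le TSuc Tpos) (auto simp: y_def)
  also have "\<dots> = 32 / 9 * ((\<Sum>j<m. y (\<xi> j)) / m)"
    by (simp add: sum_distrib_left)
  finally have "1 \<le> 128 / 9 * ((\<Sum>j<m. y (\<xi> j)) / m)" by simp
  moreover have "0 \<le> (\<Sum>j<m. y (\<xi> j)) / m" by (auto simp: y_def intro!: divide_nonneg_nonneg sum_nonneg)
  ultimately show ?thesis unfolding y_def by linarith
qed


section \<open>Discretization for all sparse sums at once\<close>

text \<open>The sample is chosen first, for the finite family of all scaled averages of dictionary
  functions. Only then is \<open>u\<close> given, and Maurey's method for that very sample selects
  averages close to \<open>u\<close>. The union bound thus ranges over averages alone.\<close>

lemma (in prob_space) universal_discretization:
  fixes \<phi> :: "nat \<Rightarrow> 'a \<Rightarrow> complex" and K B :: real and L N v m :: nat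
  assumes K: "K \<ge> 1" and N: "N \<ge> 2" and v: "v \<ge> 1" and m: "m \<ge> 1"
    and meas: "\<And>j. j \<in> {1..N} \<Longrightarrow> \<phi> j \<in> borel_measurable M"
    and bound: "\<And>j x. j \<in> {1..N} \<Longrightarrow> x \<in> space M \<Longrightarrow> cmod (\<phi> j x) \<le> 1"
    and riesz: "\<And>a. (\<Sum>j=1..N. (cmod (a j))\<^sup>2) \<le> K * (\<integral>x. (cmod (\<Sum>j=1..N. a j * \<phi> j x))\<^sup>2 \<partial>M)"
    and L: "4 * K * v \<le> 2 ^ L" "\<And>i. i < L \<Longrightarrow> 2 ^ i \<le> 4 * K * v" "L \<ge> 1"
    and B: "B = ln (128 * real L * K * v)"
    and m_ge: "2 ^ 22 * K * v * L * B * ln N \<le> m"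
  shows "\<exists>\<xi>. (\<forall>j. \<xi> j \<in> space M) \<and> (\<forall>J a. J \<subseteq> {1..N} \<and> card J = v \<longrightarrow>
    (\<integral>x. (cmod (\<Sum>j\<in>J. a j * \<phi> j x))\<^sup>2 \<partial>M) \<le>
      16 * ((\<Sum>l<m. (cmod (\<Sum>j\<in>J. a j * \<phi> j (\<xi> l)))\<^sup>2) / m))"
proof -
  define T :: "nat \<Rightarrow> real" where "T i = 2 ^ i / 4" for i
  define D where "D = K * v"
  \<comment> \<open>By Cauchy-Schwarz a normalized \<open>v\<close>-sparse sum has coefficients with
    absolute sum at most \<open>sqrt D\<close>; the 2 pays for the separation into real and
    imaginary parts.\<close>
  define R where "R = 2 * sqrt D"
  define I where "I = {1..N} \<times> insert 0 directions"
  define \<psi> where "\<psi> i x = snd i * \<phi> (fst i) x" for i x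
  \<comment> \<open>The accuracy \<open>sqrt (T i) / 8\<close> becomes
    \<open>\<tau> = sqrt (T i) / (8 * R)\<close> after division by \<open>R\<close>, so
    \<open>\<tau>\<^sup>2 = T i / (256 * D)\<close>; the requirement
    \<open>n * \<tau>\<^sup>2 / 64 \<ge> B\<close> gives 64 * 256 = 16384.\<close>
  define n where "n i = nat \<lceil>16384 * D * B / T i\<rceil>" for i
  define w where "w i xs x = R * ((\<Sum>k\<leftarrow>xs. \<psi> k x) / n i)" for i xs x
  define G where "G i = {xs. set xs \<subseteq> I \<and> length xs = n i}" for i
  define F where "F = (SIGMA i:{..<L}. G i)"
  define A where "A = (\<lambda>(i, xs). {x \<in> space M. cmod (w i xs x) > 7 / 8 * sqrt (T i)})"
  \<comment> \<open>\<open>Q / T i\<close> bounds the logarithm of the number of averages at level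
    \<open>i\<close>: at most \<open>N ^ (4 * n i)\<close> of them, with 4 * 32768 = 2 ^ 17.\<close>
  define Q where "Q = 2 ^ 17 * D * B * ln N"
  have D1: "D \<ge> 1" using mult_mono[OF K, of 1 "real v"] K v by (simp add: D_def)
  have R0: "R > 0" using D1 by (simp add: R_def)
  have T0: "T i > 0" for i by (simp add: T_def)
  have T_le: "T i \<le> D" if "i < L" for i using L(2)[OF that] by (simp add: T_def D_def)
  \<comment> \<open>The value of \<open>B\<close> is set so that \<open>8 * exp (- B)\<close> is the
    bad mass \<open>1 / (16 * L * D)\<close> allowed at every level.\<close>
  have expB: "exp (- B) = 1 / (128 * real L * D)"
    using L(3) K v by (simp add: B D_def exp_minus field_simps)
  have B1: "B \<ge> 1"
  proof -
    have "1 * 1 \<le> real L * D" using L(3) D1 by (intro mult_mono) auto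
    then have "exp 1 \<le> 128 * L * D" using exp_le by simp
    then have "ln (exp 1) \<le> ln (128 * real L * D)" by (subst ln_le_cancel_iff) (use L(3) D1 in auto)
    then show ?thesis by (simp add: B D_def mult_ac)
  qed
  have lnN: "ln N \<ge> 1 / 2"
  proof -
    have "ln (real 2) \<le> ln N" using N by (subst ln_le_cancel_iff) auto
    then show ?thesis using ln2_ge_two_thirds by simp
  qed
  have n1: "n i \<ge> 1" and n_ge: "n i \<ge> 16384 * D * B / T i" and n_le: "n i \<le> 32768 * D * B / T i"
    if "i < L" for i
  proof -
    have "1 * 1 \<le> (D / T i) * B" using T_le[OF that] T0[of i] B1 by (intro mult_mono) auto
    then have 1: "1 \<le> D * B / T i" by simp
    then show "n i \<ge> 1" unfolding n_def by linarith
    show "n i \<ge> 16384 * D * B / T i" unfolding n_def by linarith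
    define q where "q = D * B / T i"
    have "n i \<le> 16384 * q + 1"
      using 1 of_int_ceiling_le_add_one[of "16384 * q"] unfolding n_def q_def by (simp add: mult.assoc)
    then have "n i \<le> 32768 * q" using 1 unfolding q_def[symmetric] by linarith
    then show "n i \<le> 32768 * D * B / T i" by (simp add: q_def mult.assoc)
  qed
  have finI: "finite I" "card I = 5 * N"
    using card_directions by (auto simp: I_def directions_def card_cartesian_product card_insert_if)
  have \<psi>m: "\<psi> i \<in> borel_measurable M" if "i \<in> I" for i
    using meas[of "fst i"] that unfolding \<psi>_def by (auto simp: I_def)
  have \<psi>b: "cmod (\<psi> i x) \<le> 1" if "i \<in> I" "x \<in> space M" for i x
    using bound[of "fst i" x] that norm_directions[of "snd i"] by (auto simp: \<psi>_def I_def norm_mult)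
  have wm: "w i xs \<in> borel_measurable M" if "xs \<in> G i" for i xs
  proof -
    have "set xs \<subseteq> I" using that by (simp add: G_def)
    then have "(\<lambda>x. \<Sum>k\<leftarrow>xs. \<psi> k x) \<in> borel_measurable M"
      by (induction xs) (auto intro!: borel_measurable_add \<psi>m)
    then show ?thesis unfolding w_def by measurable
  qed
  have "\<exists>\<xi>::nat \<Rightarrow> 'a. (\<forall>j. \<xi> j \<in> space M) \<and>
    (\<forall>k\<in>F. prob (A k) \<le> 2 * (\<Sum>j<m. indicator (A k) (\<xi> j)) / real m + 1 / (8 * real L * T (fst k)))"
  proof (rule exists_points_prob_le)
    show "finite F" unfolding F_def G_def by (auto intro!: finite_lists_length_eq finI)
    show "A k \<in> events" if "k \<in> F" for k
    proof -
      obtain i xs where k: "k = (i, xs)" "xs \<in> G i" using \<open>k \<in> F\<close> by (auto simp: F_def)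
      note [measurable] = wm[OF k(2)]
      show ?thesis by (simp add: k(1) A_def)
    qed
    have "(\<Sum>k\<in>F. exp (- (real m * (1 / (8 * real L * T (fst k))) / 2))) =
        (\<Sum>i<L. \<Sum>xs\<in>G i. exp (- (real m * (1 / (8 * real L * T i)) / 2)))"
      unfolding F_def by (subst sum.Sigma) (auto simp: G_def case_prod_beta intro!: finite_lists_length_eq finI)
    also have "\<dots> \<le> (\<Sum>i<L. exp (- B))"
    proof (rule sum_mono)
      fix i assume "i \<in> {..<L}"
      then have i: "i < L" by simp
      have "card (G i) = (5 * N) ^ n i"
        unfolding G_def using card_lists_length_eq[OF finI(1)] finI(2) by simp
      also have "\<dots> \<le> (N ^ 4) ^ n i"
      proof (rule power_mono)
        have "5 * N \<le> 2 ^ 3 * N" by simp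
        also have "\<dots> \<le> N ^ 3 * N" using N by (intro mult_right_mono power_mono) auto
        finally show "5 * N \<le> N ^ 4" by (simp add: power_Suc2[symmetric] numeral_eq_Suc)
      qed simp
      finally have "real (card (G i)) \<le> real ((N ^ 4) ^ n i)" by (simp only: of_nat_le_iff)
      also have "\<dots> = real N ^ (4 * n i)" by (simp add: power_mult)
      also have "\<dots> = exp (4 * n i * ln N)"
        using N exp_of_nat_mult[of "4 * n i" "ln N"] by simp
      also have "\<dots> \<le> exp (Q / T i)"
      proof -
        have "4 * n i * ln N \<le> 4 * (32768 * D * B / T i) * ln N"
          using n_le[OF i] lnN by (intro mult_right_mono mult_left_mono) auto
        then show ?thesis by (simp add: Q_def)
      qed
      finally have card: "real (card (G i)) \<le> exp (Q / T i)" .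
      \<comment> \<open>Since 2 ^ 22 is 32 * 2 ^ 17, the exponent is at least
        \<open>2 * Q / T i\<close>: one half cancels the cardinality, the other leaves
        \<open>exp (- (Q / T i))\<close>.\<close>
      have "2 * Q * (16 * real L) \<le> m" using m_ge by (simp add: Q_def D_def mult_ac)
      then have "2 * Q / T i \<le> real m * (1 / (8 * real L * T i)) / 2"
        using L(3) T0[of i] by (simp add: field_simps)
      then have "exp (- (real m * (1 / (8 * real L * T i)) / 2)) \<le> exp (- (2 * Q / T i))" by simp
      then have "real (card (G i)) * exp (- (real m * (1 / (8 * real L * T i)) / 2)) \<le>
          exp (Q / T i) * exp (- (2 * Q / T i))"
        using card by (intro mult_mono) auto
      also have "\<dots> = exp (- (Q / T i))" by (simp add: exp_add[symmetric] del: exp_add)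
      also have "\<dots> \<le> exp (- B)"
      proof -
        have "B * 1 \<le> B * (2 ^ 17 * ln N * (D / T i))"
        proof (intro mult_left_mono)
          have "1 * 1 \<le> (2 ^ 17 * ln N) * (D / T i)"
            using lnN T_le[OF i] T0[of i] by (intro mult_mono) auto
          then show "1 \<le> 2 ^ 17 * ln N * (D / T i)" by simp
        qed (use B1 in auto)
        then show ?thesis by (simp add: Q_def mult_ac)
      qed
      finally show "(\<Sum>xs\<in>G i. exp (- (real m * (1 / (8 * real L * T i)) / 2))) \<le> exp (- B)" by simp
    qed
    also have "\<dots> < 1" using L(3) D1 by (simp add: expB)
    finally show "(\<Sum>k\<in>F. exp (- (real m * (1 / (8 * real L * T (fst k))) / 2))) < 1" .
  qed (rule m)
  then obtain \<xi> where \<xi>: "\<And>j. \<xi> j \<in> space M"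
    and level: "\<And>k. k \<in> F \<Longrightarrow>
      prob (A k) \<le> 2 * (\<Sum>j<m. indicator (A k) (\<xi> j)) / real m + 1 / (8 * real L * T (fst k))"
    by blast
  have unit: "1 \<le> 16 * ((\<Sum>l<m. (cmod (\<Sum>j\<in>J. a j * \<phi> j (\<xi> l)))\<^sup>2) / m)"
    if J: "J \<subseteq> {1..N}" "card J = v" and one: "(\<integral>x. (cmod (\<Sum>j\<in>J. a j * \<phi> j x))\<^sup>2 \<partial>M) = 1" for J a
  proof -
    define u where "u x = (\<Sum>j\<in>J. a j * \<phi> j x)" for x
    \<comment> \<open>Extension by zero, because the lower Riesz bound is stated for coefficients on
      the whole dictionary.\<close>
    define b where "b j = (if j \<in> J then a j else 0)" for j
    have finJ: "finite J" using J(1) finite_subset by blast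
    have ext: "(\<Sum>j=1..N. f (b j) j) = (\<Sum>j\<in>J. f (a j) j)" if "\<And>j. f 0 j = 0" for f :: "complex \<Rightarrow> nat \<Rightarrow> 'c::comm_monoid_add"
      by (rule sum.mono_neutral_cong_right) (use J(1) that in \<open>auto simp: b_def\<close>)
    have u_ext: "u x = (\<Sum>j=1..N. b j * \<phi> j x)" for x
      using ext[of "\<lambda>c j. c * \<phi> j x"] by (simp add: u_def)
    have "(\<Sum>j\<in>J. (cmod (a j))\<^sup>2) = (\<Sum>j=1..N. (cmod (b j))\<^sup>2)"
      using ext[of "\<lambda>c j. (cmod c)\<^sup>2"] by simp
    also have "\<dots> \<le> K" using riesz[of b] one unfolding u_def[symmetric] u_ext[symmetric] by simp
    finally have l2: "(\<Sum>j\<in>J. (cmod (a j))\<^sup>2) \<le> K" .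
    have "(\<Sum>j\<in>J. cmod (a j))\<^sup>2 \<le> (\<Sum>j\<in>J. (cmod (a j))\<^sup>2) * v"
      using sum_squared_le_sum_of_squares[of "\<lambda>j. cmod (a j)" J] finJ J(2) by simp
    also have "\<dots> \<le> D" unfolding D_def by (intro mult_right_mono l2) simp
    finally have l1: "(\<Sum>j\<in>J. cmod (a j)) \<le> sqrt D" by (simp add: real_le_rsqrt)
    have "(\<Sum>j=1..N. \<bar>Re (b j)\<bar> + \<bar>Im (b j)\<bar>) = (\<Sum>j\<in>J. \<bar>Re (a j)\<bar> + \<bar>Im (a j)\<bar>)"
      using ext[of "\<lambda>c j. \<bar>Re c\<bar> + \<bar>Im c\<bar>"] by simp
    also have "\<dots> \<le> (\<Sum>j\<in>J. 2 * cmod (a j))"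
    proof (rule sum_mono)
      fix j
      show "\<bar>Re (a j)\<bar> + \<bar>Im (a j)\<bar> \<le> 2 * cmod (a j)"
        using abs_Re_le_cmod[of "a j"] abs_Im_le_cmod[of "a j"] by linarith
    qed
    also have "\<dots> \<le> R" using l1 by (simp add: R_def sum_distrib_left[symmetric])
    finally obtain p where p: "\<And>i. i \<in> I \<Longrightarrow> p i \<ge> 0" "sum p I = 1"
      and mean: "\<And>y. (\<Sum>i\<in>I. of_real (p i) * (snd i * y (fst i))) = (\<Sum>j=1..N. b j * y j) / R"
      using exists_convex_weights[of N R b] N R0 unfolding I_def by auto
    interpret sa: sparse_approx M I \<psi> p \<xi> m
      by unfold_locales (use finI \<psi>m \<psi>b p \<xi> m in auto)
    have mean_eq: "sa.mean x = u x / R" for x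
      using mean[of "\<lambda>j. \<phi> j x"] by (simp add: sa.mean_def \<psi>_def u_ext)
    have "\<exists>xs\<in>G i. mixed_integral M \<xi> m
      (indicator {x \<in> space M. cmod (u x - w i xs x) > sqrt (T i) / 8}) \<le> 1 / (16 * real L * T i)"
      if i: "i < L" for i
    proof -
      define \<tau> where "\<tau> = sqrt (T i) / (8 * R)"
      have "sqrt (T i) \<le> sqrt (16\<^sup>2 * D)" using T_le[OF i] D1 by (intro real_sqrt_le_mono) simp
      then have "sqrt (T i) \<le> 16 * sqrt D" by (simp only: real_sqrt_mult real_sqrt_abs abs_numeral)
      then have \<tau>: "0 < \<tau>" "\<tau> \<le> 1" using T0[of i] R0 D1 by (auto simp: \<tau>_def R_def divide_simps)
      obtain xs where xs: "set xs \<subseteq> I" "length xs = n i" and le: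
        "mixed_integral M \<xi> m (indicator {x \<in> space M. cmod (sa.mean x - (\<Sum>k\<leftarrow>xs. \<psi> k x) / n i) > \<tau>})
          \<le> 8 * exp (- (n i * \<tau>\<^sup>2 / 64))"
        using sa.exists_sampled_mean[OF n1[OF i] \<tau>] by blast
      have "cmod (sa.mean x - (\<Sum>k\<leftarrow>xs. \<psi> k x) / n i) > \<tau> \<longleftrightarrow> cmod (u x - w i xs x) > sqrt (T i) / 8" for x
      proof -
        have "u x - w i xs x = R * (sa.mean x - (\<Sum>k\<leftarrow>xs. \<psi> k x) / n i)"
          using R0 by (simp add: mean_eq w_def right_diff_distrib)
        then have "cmod (u x - w i xs x) = R * cmod (sa.mean x - (\<Sum>k\<leftarrow>xs. \<psi> k x) / n i)"
          using R0 by (simp add: norm_mult)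
        then show ?thesis using R0 by (simp add: \<tau>_def field_simps)
      qed
      with le have "mixed_integral M \<xi> m (indicator {x \<in> space M. cmod (u x - w i xs x) > sqrt (T i) / 8})
          \<le> 8 * exp (- (n i * \<tau>\<^sup>2 / 64))" by simp
      also have "\<dots> \<le> 8 * exp (- B)"
      proof -
        have \<tau>_sq: "\<tau>\<^sup>2 = T i / (256 * D)"
          using T0[of i] D1 by (simp add: \<tau>_def R_def power_divide power_mult_distrib)
        have "n i * \<tau>\<^sup>2 / 64 \<ge> (16384 * D * B / T i) * (T i / (256 * D)) / 64"
          unfolding \<tau>_sq using T0[of i] D1 by (intro divide_right_mono mult_right_mono n_ge[OF i]) auto
        also have "(16384 * D * B / T i) * (T i / (256 * D)) / 64 = B"
          using T0[of i] D1 by simp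
        finally show ?thesis by simp
      qed
      also have "\<dots> = 1 / (16 * real L * D)" by (simp add: expB)
      also have "\<dots> \<le> 1 / (16 * real L * T i)"
        using T_le[OF i] T0[of i] L(3) by (intro divide_left_mono mult_left_mono) auto
      finally show ?thesis using xs by (auto simp: G_def)
    qed
    then have "\<forall>i\<in>{..<L}. \<exists>ys. ys \<in> G i \<and> mixed_integral M \<xi> m
      (indicator {x \<in> space M. cmod (u x - w i ys x) > sqrt (T i) / 8}) \<le> 1 / (16 * real L * T i)"
      by blast
    from bchoice[OF this] obtain xs where xs: "\<And>i. i < L \<Longrightarrow> xs i \<in> G i" and
      bad: "\<And>i. i < L \<Longrightarrow> mixed_integral M \<xi> m
        (indicator {x \<in> space M. cmod (u x - w i (xs i) x) > sqrt (T i) / 8}) \<le> 1 / (16 * real L * T i)"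
      by blast
    have "1 \<le> 16 * ((\<Sum>l<m. (cmod (u (\<xi> l)))\<^sup>2) / m)"
    proof (rule one_le_of_level_sets[where T = T and L = L and w = "\<lambda>i. w i (xs i)"])
      show "u \<in> borel_measurable M"
        unfolding u_def using meas J(1) by (intro borel_measurable_sum borel_measurable_times) auto
      \<comment> \<open>The bound on the coefficients also bounds \<open>u\<close> pointwise, so no
        value exceeds the top level.\<close>
      show "(cmod (u x))\<^sup>2 \<le> T L" if "x \<in> space M" for x
      proof -
        have "cmod (u x) \<le> (\<Sum>j\<in>J. cmod (a j))"
          unfolding u_def using bound[OF _ that] J(1)
          by (intro sum_norm_le) (auto simp: norm_mult intro!: mult_left_le)
        with l1 have "(cmod (u x))\<^sup>2 \<le> (sqrt D)\<^sup>2" by (intro power_mono) auto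
        then show ?thesis using L(1) D1 by (simp add: T_def D_def)
      qed
      show "prob {x \<in> space M. cmod (w i (xs i) x) > 7 / 8 * sqrt (T i)} \<le>
        2 * (\<Sum>j<m. indicator {x \<in> space M. cmod (w i (xs i) x) > 7 / 8 * sqrt (T i)} (\<xi> j)) / real m
          + 1 / (8 * real L * T i)" if "i < L" for i
        using level[of "(i, xs i)"] xs[OF that] that by (simp add: F_def A_def)
    qed (use wm xs bad \<xi> m one in \<open>auto simp: T_def u_def\<close>)
    then show ?thesis by (simp add: u_def)
  qed
  have "(\<integral>x. (cmod (\<Sum>j\<in>J. a j * \<phi> j x))\<^sup>2 \<partial>M) \<le>
      16 * ((\<Sum>l<m. (cmod (\<Sum>j\<in>J. a j * \<phi> j (\<xi> l)))\<^sup>2) / m)"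
    if J: "J \<subseteq> {1..N}" "card J = v" for J a
  proof -
    \<comment> \<open>Homogeneity: unless \<open>S\<close> vanishes, division by
      \<open>sqrt S\<close> reduces to the normalized case.\<close>
    define S where "S = (\<integral>x. (cmod (\<Sum>j\<in>J. a j * \<phi> j x))\<^sup>2 \<partial>M)"
    have "S \<ge> 0" unfolding S_def by simp
    have scale: "(cmod (\<Sum>j\<in>J. a j / sqrt S * \<phi> j x))\<^sup>2 = (cmod (\<Sum>j\<in>J. a j * \<phi> j x))\<^sup>2 / S" for x
    proof -
      have "(\<Sum>j\<in>J. a j / sqrt S * \<phi> j x) = (\<Sum>j\<in>J. a j * \<phi> j x) / sqrt S"
        by (simp add: sum_divide_distrib)
      then show ?thesis using \<open>S \<ge> 0\<close> by (simp add: norm_divide power_divide)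
    qed
    show ?thesis
    proof (cases "S = 0")
      case True
      then show ?thesis unfolding S_def by (auto intro!: divide_nonneg_nonneg sum_nonneg)
    next
      case False
      then have "S > 0" using \<open>S \<ge> 0\<close> by simp
      have "1 \<le> 16 * ((\<Sum>l<m. (cmod (\<Sum>j\<in>J. a j / sqrt S * \<phi> j (\<xi> l)))\<^sup>2) / m)"
        by (rule unit[OF J], unfold scale) (use \<open>S > 0\<close> in \<open>simp add: S_def[symmetric]\<close>)
      then show ?thesis using \<open>S > 0\<close> m
        unfolding scale sum_divide_distrib[symmetric] S_def[symmetric] by (simp add: field_simps)
    qed
  qed
  with \<xi> show ?thesis by blast
qed


section \<open>Number of levels and the final sample size\<close>

text \<open>Minimality of \<open>L\<close> makes it logarithmic in \<open>K * v\<close>. Crude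
  bounds such as \<open>ln K \<le> K\<close> and \<open>K \<le> 2 * K * ln (2 * v)\<close> keep the
  dependence on \<open>K\<close> polynomial.\<close>

lemma exists_level_count:
  fixes K :: real and v :: nat
  assumes K: "K \<ge> 1" and v: "v \<ge> 1"
  obtains L :: nat where "4 * K * v \<le> 2 ^ L" "\<And>i. i < L \<Longrightarrow> 2 ^ i \<le> 4 * K * v" "L \<ge> 1"
    "L \<le> 12 * K * ln (2 * v)" "ln (128 * real L * K * v) \<le> 21 * K * ln (2 * v)"
proof -
  define l where "l = ln (2 * real v)"
  have "ln 2 \<le> l" unfolding l_def using v by (subst ln_le_cancel_iff) auto
  then have l: "l \<ge> 1 / 2" using ln2_ge_two_thirds by simp
  have Kl: "K \<le> 2 * K * l" using mult_left_mono[OF l, of "2 * K"] K by simp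
  have Kv: "1 \<le> K * v" using mult_mono[OF K, of 1 "real v"] K v by simp
  have ex: "\<exists>n. 4 * K * v \<le> 2 ^ n"
    using real_arch_pow[of 2 "4 * K * v"] less_imp_le by auto
  define L where "L = (LEAST n. 4 * K * v \<le> 2 ^ n)"
  have ge: "4 * K * v \<le> 2 ^ L" unfolding L_def by (rule LeastI_ex[OF ex])
  have less: "2 ^ i < 4 * K * v" if "i < L" for i
    using not_less_Least[of i "\<lambda>n. 4 * K * v \<le> 2 ^ n"] that by (simp add: L_def)
  have "L \<noteq> 0" using ge Kv by (intro notI) simp
  then have L1: "L \<ge> 1" by simp
  have lnK: "ln K \<le> K" using ln_le_minus_one[of K] K by simp
  have "ln (2 ^ (L - 1)) \<le> ln (4 * K * v)"
    by (subst ln_le_cancel_iff) (use less[of "L - 1"] L1 Kv in auto)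
  also have "\<dots> = ln 2 + ln K + l"
  proof -
    have "4 * K * v = 2 * K * (2 * v)" by simp
    then show ?thesis using K v unfolding l_def by (simp only: ln_mult) (simp add: ln_mult)
  qed
  finally have "(L - 1) * ln 2 \<le> ln 2 + ln K + l" by (simp add: ln_realpow)
  then have "L * ln 2 \<le> 2 * ln 2 + ln K + l" using L1 by (simp add: of_nat_diff algebra_simps)
  moreover have "L * (1 / 2) \<le> L * ln 2" using ln2_ge_two_thirds by (intro mult_left_mono) auto
  moreover have "l \<le> K * l" using mult_right_mono[OF K, of l] l by simp
  ultimately have L_le: "L \<le> 12 * K * l" using \<open>ln 2 \<le> l\<close> lnK Kl by linarith
  have "ln (128 * real L * K * v) = ln (2 ^ 6) + ln L + ln K + l"
  proof -
    have "128 * L * K * v = 2 ^ 6 * L * K * (2 * v)" by simp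
    moreover have "ln (128 :: real) = ln 64 + ln 2" using ln_mult[of 64 "2 :: real"] by simp
    ultimately show ?thesis using K v L1 unfolding l_def by (simp only: ln_mult) (simp add: ln_mult)
  qed
  also have "ln (2 ^ 6 :: real) = 6 * ln 2" by (subst ln_realpow) auto
  also have "ln L \<le> L" using ln_le_minus_one[of L] L1 by simp
  finally have "ln (128 * real L * K * v) \<le> 21 * K * l"
    using L_le \<open>ln 2 \<le> l\<close> lnK Kl \<open>l \<le> K * l\<close> by linarith
  with L_le that[OF ge less_imp_le[OF less] L1] show ?thesis by (simp add: l_def)
qed

text \<open>The double logarithm is negative for \<open>N = 2\<close>, but the sum is the logarithm
  of \<open>2 * v * ln N\<close>, which is at least 4/3. This lets the last factor of the sampling
  condition be bounded below by 1/4.\<close>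

lemma ln_2v_plus_lnln_ge:
  assumes "v \<ge> 1" "N \<ge> 2"
  shows "ln (2 * real v) + ln (ln (real N)) \<ge> 1 / 4"
proof -
  have "ln 2 \<le> ln (real N)" using assms by (subst ln_le_cancel_iff) auto
  then have lnN: "ln (real N) \<ge> 2 / 3" using ln2_ge_two_thirds by simp
  then have "2 * (2 / 3) \<le> 2 * real v * ln (real N)" using assms by (intro mult_mono) auto
  then have "ln (4 / 3) \<le> ln (2 * real v * ln (real N))" by simp
  also have "\<dots> = ln (2 * real v) + ln (ln (real N))" using assms lnN by (intro ln_mult_pos) auto
  finally have "ln (4 / 3) \<le> ln (2 * real v) + ln (ln (real N))" .
  moreover have "ln (3 / 4 :: real) \<le> 3 / 4 - 1" by (rule ln_le_minus_one) simp
  moreover have "ln (3 / 4 :: real) = - ln (4 / 3)" using ln_inverse[of "4 / 3 :: real"] by simp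
  ultimately show ?thesis by linarith
qed

lemma (in prob_space) exists_discretizing_points:
  fixes \<phi> :: "nat \<Rightarrow> 'a \<Rightarrow> complex" and K :: real and N v m :: nat
  assumes K: "K \<ge> 1" and v: "1 \<le> v" "v \<le> N" and m: "m \<ge> 1"
    and meas: "\<And>j. j \<in> {1..N} \<Longrightarrow> \<phi> j \<in> borel_measurable M"
    and bound: "\<And>j x. j \<in> {1..N} \<Longrightarrow> x \<in> space M \<Longrightarrow> cmod (\<phi> j x) \<le> 1"
    and riesz: "\<And>a. (\<Sum>j=1..N. (cmod (a j))\<^sup>2) \<le> K * (\<integral>x. (cmod (\<Sum>j=1..N. a j * \<phi> j x))\<^sup>2 \<partial>M)"
    and m_ge: "2 ^ 32 * K ^ 3 * v * ln N * (ln (2 * real v))\<^sup>2 * (ln (2 * real v) + ln (ln (real N))) \<le> m"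
  shows "\<exists>\<xi>. (\<forall>j. \<xi> j \<in> space M) \<and> (\<forall>J a. J \<subseteq> {1..N} \<and> card J = v \<longrightarrow>
    (\<integral>x. (cmod (\<Sum>j\<in>J. a j * \<phi> j x))\<^sup>2 \<partial>M) \<le>
      16 * ((\<Sum>l<m. (cmod (\<Sum>j\<in>J. a j * \<phi> j (\<xi> l)))\<^sup>2) / m))"
proof (cases "N = 1")
  \<comment> \<open>Here \<open>ln N = 0\<close>, so the sampling condition is vacuous. One point
    where |\<open>\<phi> 1\<close>|^2 is at least its mean, repeated \<open>m\<close> times,
    suffices.\<close>
  case True
  then have [simp]: "v = 1" using v by simp
  have [measurable]: "\<phi> (Suc 0) \<in> borel_measurable M" using meas[of 1] True by simp
  let ?S = "\<integral>x. (cmod (\<phi> 1 x))\<^sup>2 \<partial>M"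
  have "integrable M (\<lambda>x. - (cmod (\<phi> 1 x))\<^sup>2)"
    by (rule integrable_const_bound[of _ 1])
      (use bound[of 1] True in \<open>auto simp: norm_power abs_square_le_1\<close>)
  then obtain x where x: "x \<in> space M" "?S \<le> (cmod (\<phi> 1 x))\<^sup>2"
    using exists_le_expectation[of "\<lambda>x. - (cmod (\<phi> 1 x))\<^sup>2" "- ?S"] by auto
  show ?thesis
  proof (intro exI[of _ "\<lambda>_. x"] conjI allI impI)
    fix J and a :: "nat \<Rightarrow> complex" assume "J \<subseteq> {1..N} \<and> card J = v"
    then have J: "J = {1}" using True by (auto simp: card_1_singleton_iff)
    have "(\<integral>x. (cmod (\<Sum>j\<in>J. a j * \<phi> j x))\<^sup>2 \<partial>M) = (cmod (a 1))\<^sup>2 * ?S"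
      by (simp add: J norm_mult power_mult_distrib)
    also have "\<dots> \<le> (cmod (a 1))\<^sup>2 * (16 * (cmod (\<phi> 1 x))\<^sup>2)"
    proof (rule mult_left_mono)
      have "0 \<le> ?S" by simp
      then show "?S \<le> 16 * (cmod (\<phi> 1 x))\<^sup>2" using x(2) by linarith
    qed simp
    finally show "(\<integral>x. (cmod (\<Sum>j\<in>J. a j * \<phi> j x))\<^sup>2 \<partial>M) \<le>
      16 * ((\<Sum>l<m. (cmod (\<Sum>j\<in>J. a j * \<phi> j x))\<^sup>2) / m)"
      using m by (simp add: J norm_mult power_mult_distrib)
  qed (use x in auto)
next
  case False
  then have N: "N \<ge> 2" using v by simp
  obtain L :: nat where L: "4 * K * v \<le> 2 ^ L" "\<And>i. i < L \<Longrightarrow> 2 ^ i \<le> 4 * K * v" "L \<ge> 1"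
    "L \<le> 12 * K * ln (2 * v)" "ln (128 * real L * K * v) \<le> 21 * K * ln (2 * v)"
    using exists_level_count[OF K v(1)] by blast
  define l where "l = ln (2 * real v)"
  have l0: "l \<ge> 0" using v by (simp add: l_def)
  have lnN: "ln N \<ge> 0" using N by simp
  have "L * ln (128 * real L * K * v) \<le> (12 * K * l) * (21 * K * l)"
  proof (rule mult_mono)
    have "1 * 1 * 1 * 1 \<le> 128 * real L * K * real v" using K v L(3) by (intro mult_mono) auto
    then show "0 \<le> ln (128 * real L * K * v)" by simp
  qed (use L l0 K in \<open>auto simp: l_def\<close>)
  then have "2 ^ 22 * K * v * ln N * (L * ln (128 * real L * K * v)) \<le>
      2 ^ 22 * K * v * ln N * ((12 * K * l) * (21 * K * l))"
    using K lnN by (intro mult_left_mono) auto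
  also have "\<dots> = (2 ^ 22 * 252) * (K ^ 3 * v * ln N * l\<^sup>2)"
    by (simp add: power2_eq_square power3_eq_cube)
  \<comment> \<open>12 * 21 = 252 is below 2 ^ 8, and the factor 1/4 is the lower bound for the
    logarithmic sum that follows.\<close>
  also have "\<dots> \<le> (2 ^ 32 * (1 / 4)) * (K ^ 3 * v * ln N * l\<^sup>2)"
    using K lnN by (intro mult_right_mono) auto
  also have "\<dots> = 2 ^ 32 * K ^ 3 * v * ln N * l\<^sup>2 * (1 / 4)" by simp
  also have "\<dots> \<le> 2 ^ 32 * K ^ 3 * v * ln N * l\<^sup>2 * (l + ln (ln (real N)))"
    using ln_2v_plus_lnln_ge[OF v(1) N] K lnN unfolding l_def by (intro mult_left_mono) auto
  also have "\<dots> \<le> m" using m_ge by (simp add: l_def)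
  finally have "2 ^ 22 * K * v * L * ln (128 * real L * K * v) * ln N \<le> m" by (simp add: mult_ac)
  from universal_discretization[OF K N v(1) m meas bound riesz L(1-3) refl this] show ?thesis .
qed

section \<open>Least squares as a projection\<close>

text \<open>The least squares approximant \<open>p\<close> is an orthogonal projection: comparing it with
  \<open>p + t * (g - p)\<close> and letting \<open>t\<close> tend to 0 gives the Pythagorean inequality.\<close>
lemma is_LS_dist_le:
  assumes LS: "is_LS m \<xi> (dict_span \<phi> J) f p" and g: "g \<in> dict_span \<phi> J" and m: "m \<ge> 1"
  shows "(\<Sum>j<m. (cmod (g (\<xi> j) - p (\<xi> j)))\<^sup>2) \<le> (\<Sum>j<m. (cmod (f (\<xi> j) - g (\<xi> j)))\<^sup>2)"
proof -
  define A where "A = (\<Sum>j<m. (cmod (f (\<xi> j) - p (\<xi> j)))\<^sup>2)"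
  define G where "G = (\<Sum>j<m. (cmod (f (\<xi> j) - g (\<xi> j)))\<^sup>2)"
  define W where "W = (\<Sum>j<m. (cmod (g (\<xi> j) - p (\<xi> j)))\<^sup>2)"
  obtain c where c: "p = (\<lambda>x. \<Sum>j\<in>J. c j * \<phi> j x)"
    using LS by (auto simp: is_LS_def dict_span_def)
  obtain b where b: "g = (\<lambda>x. \<Sum>j\<in>J. b j * \<phi> j x)"
    using g by (auto simp: dict_span_def)
  have A_le: "A \<le> (1 - t) * A + t * G - t * (1 - t) * W" for t
  proof -
    have "(\<lambda>x. p x + t * (g x - p x)) = (\<lambda>x. \<Sum>j\<in>J. (c j + t * (b j - c j)) * \<phi> j x)"
      by (simp add: b c sum_distrib_left sum.distrib sum_subtractf algebra_simps)
    then have "(\<lambda>x. p x + t * (g x - p x)) \<in> dict_span \<phi> J"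
      by (auto simp: dict_span_def)
    then have "A \<le> (\<Sum>j<m. (cmod (f (\<xi> j) - (p (\<xi> j) + t * (g (\<xi> j) - p (\<xi> j)))))\<^sup>2)"
      using LS m by (auto simp: is_LS_def A_def divide_le_cancel)
    \<comment> \<open>The pointwise identity for the squared distance to a point on a line; the term
      \<open>t * (1 - t) * W\<close> measures the strict convexity.\<close>
    also have "\<dots> = (1 - t) * A + t * G - t * (1 - t) * W"
      unfolding A_def G_def W_def sum_distrib_left sum.distrib[symmetric] sum_subtractf[symmetric]
      by (intro sum.cong refl) (simp only: cmod_power2, simp add: power2_eq_square algebra_simps)
    finally show ?thesis .
  qed
  have W_le: "A + (1 - t) * W \<le> G" if "t > 0" for t
  proof -
    have "t * (A + (1 - t) * W) \<le> t * G" using A_le[of t] by (simp add: algebra_simps)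
    then show ?thesis using that by simp
  qed
  have "((\<lambda>t. A + (1 - t) * W) \<longlongrightarrow> A + (1 - 0) * W) (at_right 0)"
    by (intro tendsto_intros)
  moreover have "eventually (\<lambda>t. A + (1 - t) * W \<le> G) (at_right 0)"
    by (rule eventually_at_right_less[THEN eventually_mono]) (use W_le in auto)
  ultimately have "A + W \<le> G" using tendsto_upperbound[of _ _ "at_right (0::real)" G] by fastforce
  moreover have "A \<ge> 0" by (auto simp: A_def intro: sum_nonneg)
  ultimately show ?thesis by (simp add: W_def G_def)
qed

text \<open>The weights 1 + 4 and 1 + 1/4 are those minimizing the final constant: the second is
  multiplied by 16 below, and 5 + 20 = 25 is the square of the 5 in the theorem.\<close>

lemma norm_add_sq_le: "(cmod (x + y))\<^sup>2 \<le> 5 * (cmod x)\<^sup>2 + 5 / 4 * (cmod y)\<^sup>2"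
proof -
  have "(cmod (x + y))\<^sup>2 \<le> (cmod x + cmod y)\<^sup>2"
    by (intro power_mono norm_triangle_ineq) simp
  also have "\<dots> = 5 * (cmod x)\<^sup>2 + 5 / 4 * (cmod y)\<^sup>2 - (2 * cmod x - cmod y / 2)\<^sup>2"
    by (simp add: power2_eq_square field_simps)
  also have "\<dots> \<le> 5 * (cmod x)\<^sup>2 + 5 / 4 * (cmod y)\<^sup>2" by simp
  finally show ?thesis .
qed

lemma (in prob_space) L2norm_sub_LS_le:
  fixes f g p :: "'a \<Rightarrow> complex"
  assumes LS: "is_LS m \<xi> (dict_span \<phi> J) f p" and g: "g \<in> dict_span \<phi> J" and m: "m \<ge> 1"
    and disc: "\<And>a. (\<integral>x. (cmod (\<Sum>j\<in>J. a j * \<phi> j x))\<^sup>2 \<partial>M) \<le>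
      16 * ((\<Sum>l<m. (cmod (\<Sum>j\<in>J. a j * \<phi> j (\<xi> l)))\<^sup>2) / m)"
    and int: "integrable M (\<lambda>x. (cmod (f x - g x))\<^sup>2)" "integrable M (\<lambda>x. (cmod (g x - p x))\<^sup>2)"
      "integrable M (\<lambda>x. (cmod (f x - p x))\<^sup>2)"
  shows "(L2norm M (\<lambda>x. f x - p x))\<^sup>2 \<le>
    5 * (\<integral>x. (cmod (f x - g x))\<^sup>2 \<partial>M) + 20 * ((\<Sum>l<m. (cmod (f (\<xi> l) - g (\<xi> l)))\<^sup>2) / m)"
proof -
  obtain c where c: "p = (\<lambda>x. \<Sum>j\<in>J. c j * \<phi> j x)"
    using LS by (auto simp: is_LS_def dict_span_def)
  obtain b where b: "g = (\<lambda>x. \<Sum>j\<in>J. b j * \<phi> j x)"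
    using g by (auto simp: dict_span_def)
  have "(L2norm M (\<lambda>x. f x - p x))\<^sup>2 = (\<integral>x. (cmod (f x - p x))\<^sup>2 \<partial>M)"
    by (simp add: L2norm_def)
  also have "\<dots> \<le> (\<integral>x. 5 * (cmod (f x - g x))\<^sup>2 + 5 / 4 * (cmod (g x - p x))\<^sup>2 \<partial>M)"
  proof (rule integral_mono)
    show "(cmod (f x - p x))\<^sup>2 \<le> 5 * (cmod (f x - g x))\<^sup>2 + 5 / 4 * (cmod (g x - p x))\<^sup>2" for x
      using norm_add_sq_le[of "f x - g x" "g x - p x"] by simp
  qed (use int in auto)
  also have "\<dots> = 5 * (\<integral>x. (cmod (f x - g x))\<^sup>2 \<partial>M) + 5 / 4 * (\<integral>x. (cmod (g x - p x))\<^sup>2 \<partial>M)"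
    using int by simp
  \<comment> \<open>Both functions lie in the span over \<open>J\<close>, hence so does their
    difference, and no discretization of \<open>f\<close> itself is required.\<close>
  also have "(\<integral>x. (cmod (g x - p x))\<^sup>2 \<partial>M) \<le> 16 * ((\<Sum>l<m. (cmod (g (\<xi> l) - p (\<xi> l)))\<^sup>2) / m)"
    using disc[of "\<lambda>j. b j - c j"] by (simp add: b c sum_subtractf left_diff_distrib)
  also have "(\<Sum>l<m. (cmod (g (\<xi> l) - p (\<xi> l)))\<^sup>2) / m \<le> (\<Sum>l<m. (cmod (f (\<xi> l) - g (\<xi> l)))\<^sup>2) / m"
    by (intro divide_right_mono is_LS_dist_le[OF LS g m]) simp
  finally show ?thesis by simp
qed


section \<open>Passage to best approximation errors\<close>

text \<open>Multiplication by a positive finite constant is an order isomorphism of the extended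
  half-line, so the constant can be divided out before taking the infimum.\<close>

lemma le_mult_INF_ennreal:
  fixes c X :: ennreal
  assumes "c \<noteq> 0" "c \<noteq> top" "\<And>i. i \<in> I \<Longrightarrow> X \<le> c * f i"
  shows "X \<le> c * (INF i\<in>I. f i)"
proof -
  have X: "X = c * (X / c)"
    using assms(1,2) by (simp add: ennreal_times_divide mult_divide_eq_ennreal mult.commute[of c])
  have "X / c \<le> f i" if "i \<in> I" for i
    using assms(3)[OF that] ennreal_mult_le_mult_iff[OF assms(1,2)] X by metis
  then have "X / c \<le> (INF i\<in>I. f i)" by (rule INF_greatest)
  then show ?thesis using X ennreal_mult_le_mult_iff[OF assms(1,2)] by metis
qed

text \<open>The norm is left arbitrary so that both inequalities of the theorem follow. A competitor
  \<open>g\<close> lies in the span over some \<open>J\<close>, and that \<open>J\<close> is the one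
  used in the minimum over subspaces.\<close>

lemma rho_ls_le_sigma_v:
  assumes "c > 0" "\<xi> \<in> points \<Omega> m"
    and le: "\<And>f J g. f \<in> F \<Longrightarrow> J \<in> subsets_v N v \<Longrightarrow> g \<in> dict_span \<phi> J \<Longrightarrow>
      ennreal (L2norm M (\<lambda>x. f x - LS \<xi> J f x)) \<le> ennreal c * nrm (\<lambda>x. f x - g x)"
  shows "rho_ls \<Omega> M m v N F LS \<le> ennreal c * sigma_v nrm F \<phi> N v"
proof -
  have "rho_ls \<Omega> M m v N F LS \<le>
      (SUP f\<in>F. INF J\<in>subsets_v N v. ennreal (L2norm M (\<lambda>x. f x - LS \<xi> J f x)))"
    unfolding rho_ls_def by (rule INF_lower[OF assms(2)])
  also have "\<dots> \<le> (SUP f\<in>F. ennreal c * (INF g\<in>Sigma_v \<phi> N v. nrm (\<lambda>x. f x - g x)))"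
  proof (rule SUP_subset_mono[OF order_refl], rule le_mult_INF_ennreal)
    fix f g assume "f \<in> F" "g \<in> Sigma_v \<phi> N v"
    then obtain J where "J \<in> subsets_v N v" "g \<in> dict_span \<phi> J" by (auto simp: Sigma_v_def)
    then show "(INF J\<in>subsets_v N v. ennreal (L2norm M (\<lambda>x. f x - LS \<xi> J f x))) \<le>
        ennreal c * nrm (\<lambda>x. f x - g x)"
      using le[OF \<open>f \<in> F\<close>] by (intro INF_lower2)
  qed (use assms(1) in auto)
  finally show ?thesis by (simp add: sigma_v_def SUP_mult_left_ennreal)
qed

text \<open>Guards the integral estimates: a non-integrable function would have integral 0 by
  convention, and monotonicity could fail.\<close>

lemma integrable_cmod_sq_continuous:
  fixes M :: "'a::topological_space measure" and h :: "'a \<Rightarrow> complex"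
  assumes "prob_space M" "compact \<Omega>" "sets M = sets (restrict_space borel \<Omega>)" and h: "continuous_on \<Omega> h"
  shows "integrable M (\<lambda>x. (cmod (h x))\<^sup>2)"
proof -
  interpret prob_space M by (rule assms)
  have "space M = \<Omega>" using sets_eq_imp_space_eq[OF assms(3)] by (simp add: space_restrict_space)
  have [measurable]: "h \<in> borel_measurable M"
    using borel_measurable_continuous_on_restrict[OF h] measurable_cong_sets[OF assms(3) refl] by blast
  have "bounded (h ` \<Omega>)" by (intro compact_imp_bounded compact_continuous_image h assms(2))
  then obtain B where B: "\<And>x. x \<in> \<Omega> \<Longrightarrow> cmod (h x) \<le> B" by (auto simp: bounded_iff)
  show ?thesis
  proof (rule integrable_const_bound)
    show "AE x in M. norm ((cmod (h x))\<^sup>2) \<le> B\<^sup>2"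
      using B \<open>space M = \<Omega>\<close> by (intro AE_I2) (auto intro!: power_mono)
  qed measurable
qed

theorem theorem1p3:
  fixes K :: real
  assumes "K \<ge> 1"
  shows "\<exists>C::real. C \<ge> 1 \<and>
    (\<forall>(d::nat) (\<Omega>::(nat \<Rightarrow> real) set) (M::(nat \<Rightarrow> real) measure)
       (N::nat) (\<phi>::nat \<Rightarrow> (nat \<Rightarrow> real) \<Rightarrow> complex) (F::((nat \<Rightarrow> real) \<Rightarrow> complex) set)
       (v::nat) (m::nat) LS.
       \<Omega> \<subseteq> {x. \<forall>i\<ge>d. x i = 0} \<and> compact \<Omega> \<and>
       prob_space M \<and> sets M = sets (restrict_space borel \<Omega>) \<and>
       (\<forall>j\<in>{1..N}. continuous_on \<Omega> (\<phi> j) \<and> (\<forall>x\<in>\<Omega>. cmod (\<phi> j x) \<le> 1)) \<and>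
       (\<forall>a::nat \<Rightarrow> complex. (\<Sum>j=1..N. (cmod (a j))^2)
            \<le> K * (L2norm M (\<lambda>x. \<Sum>j=1..N. a j * \<phi> j x))^2) \<and>
       compact_C \<Omega> F \<and>
       1 \<le> v \<and> v \<le> N \<and> 1 \<le> m \<and>
       real m \<ge> C * real v * ln (real N) * (ln (2 * real v))^2
                   * (ln (2 * real v) + ln (ln (real N))) \<and>
       (\<forall>\<xi> J f. is_LS m \<xi> (dict_span \<phi> J) f (LS \<xi> J f))
     \<longrightarrow> rho_ls \<Omega> M m v N F LS \<le> ennreal (5 * sqrt 2) * sigma_2m \<Omega> M m F \<phi> N v
       \<and> rho_ls \<Omega> M m v N F LS \<le> 5 * sigma_v (supnorm \<Omega>) F \<phi> N v)"
proof (intro exI[of _ "2 ^ 32 * K ^ 3"] conjI allI impI; (elim conjE)?)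
  show "2 ^ 32 * K ^ 3 \<ge> 1"
    using mult_mono[of 1 "2 ^ 32" 1 "K ^ 3"] one_le_power[OF assms, of 3] by simp
next
  fix d \<Omega> M N and \<phi> :: "nat \<Rightarrow> (nat \<Rightarrow> real) \<Rightarrow> complex" and F v m LS
  assume comp: "compact \<Omega>" and M: "prob_space M" "sets M = sets (restrict_space borel \<Omega>)"
    and \<phi>: "\<forall>j\<in>{1..N}. continuous_on \<Omega> (\<phi> j) \<and> (\<forall>x\<in>\<Omega>. cmod (\<phi> j x) \<le> 1)"
    and riesz: "\<forall>a. (\<Sum>j=1..N. (cmod (a j))^2) \<le> K * (L2norm M (\<lambda>x. \<Sum>j=1..N. a j * \<phi> j x))^2"
    and F: "compact_C \<Omega> F" and v: "1 \<le> v" "v \<le> N" and m: "1 \<le> m"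
    and m_ge: "2 ^ 32 * K ^ 3 * real v * ln (real N) * (ln (2 * real v))^2
      * (ln (2 * real v) + ln (ln (real N))) \<le> real m"
    and LS: "\<forall>\<xi> J f. is_LS m \<xi> (dict_span \<phi> J) f (LS \<xi> J f)"
  interpret prob_space M by (rule M)
  have space: "space M = \<Omega>" using sets_eq_imp_space_eq[OF M(2)] by (simp add: space_restrict_space)
  have meas: "\<phi> j \<in> borel_measurable M" if "j \<in> {1..N}" for j
    using borel_measurable_continuous_on_restrict[of \<Omega> "\<phi> j"] \<phi> that
      measurable_cong_sets[OF M(2) refl] by blast
  \<comment> \<open>The points depend on the dictionary and the measure but not on \<open>f\<close>,
    so one sample serves all of \<open>F\<close> and both inequalities.\<close>
  have "\<exists>\<xi>. (\<forall>j. \<xi> j \<in> space M) \<and> (\<forall>J a. J \<subseteq> {1..N} \<and> card J = v \<longrightarrow>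
    (\<integral>x. (cmod (\<Sum>j\<in>J. a j * \<phi> j x))\<^sup>2 \<partial>M) \<le>
      16 * ((\<Sum>l<m. (cmod (\<Sum>j\<in>J. a j * \<phi> j (\<xi> l)))\<^sup>2) / m))"
  proof (rule exists_discretizing_points[OF assms v m meas _ _ m_ge])
    show "cmod (\<phi> j x) \<le> 1" if "j \<in> {1..N}" "x \<in> space M" for j x
      using \<phi> that by (simp add: space)
    show "(\<Sum>j=1..N. (cmod (a j))\<^sup>2) \<le> K * (\<integral>x. (cmod (\<Sum>j=1..N. a j * \<phi> j x))\<^sup>2 \<partial>M)" for a
      using riesz by (simp add: L2norm_def)
  qed
  then obtain \<xi> where \<xi>: "\<And>j. \<xi> j \<in> \<Omega>" and disc: "\<And>J a. J \<subseteq> {1..N} \<Longrightarrow> card J = v \<Longrightarrow>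
    (\<integral>x. (cmod (\<Sum>j\<in>J. a j * \<phi> j x))\<^sup>2 \<partial>M) \<le>
      16 * ((\<Sum>l<m. (cmod (\<Sum>j\<in>J. a j * \<phi> j (\<xi> l)))\<^sup>2) / m)"
    unfolding space by blast
  have \<xi>_points: "\<xi> \<in> points \<Omega> m" using \<xi> by (simp add: points_def)
  have err: "(L2norm M (\<lambda>x. f x - LS \<xi> J f x))\<^sup>2 \<le>
    5 * (\<integral>x. (cmod (f x - g x))\<^sup>2 \<partial>M) + 20 * ((\<Sum>l<m. (cmod (f (\<xi> l) - g (\<xi> l)))\<^sup>2) / m)"
    and int: "integrable M (\<lambda>x. (cmod (f x - g x))\<^sup>2)"
    if "f \<in> F" "J \<in> subsets_v N v" "g \<in> dict_span \<phi> J" for f J g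
  proof -
    have J: "J \<subseteq> {1..N}" "card J = v" using that(2) by (auto simp: subsets_v_def)
    have ls: "is_LS m \<xi> (dict_span \<phi> J) f (LS \<xi> J f)" using LS by blast
    have span: "continuous_on \<Omega> u" if "u \<in> dict_span \<phi> J" for u
      using that J(1) \<phi> by (auto simp: dict_span_def intro!: continuous_intros)
    have "continuous_on \<Omega> f" using F that(1) by (simp add: compact_C_def)
    moreover have "continuous_on \<Omega> g" by (rule span) (rule that)
    moreover have "continuous_on \<Omega> (LS \<xi> J f)" using ls by (intro span) (simp add: is_LS_def)
    ultimately have ints: "integrable M (\<lambda>x. (cmod (f x - g x))\<^sup>2)"
      "integrable M (\<lambda>x. (cmod (g x - LS \<xi> J f x))\<^sup>2)"
      "integrable M (\<lambda>x. (cmod (f x - LS \<xi> J f x))\<^sup>2)"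
      by (auto intro!: integrable_cmod_sq_continuous[OF M(1) comp M(2)] continuous_intros)
    show "integrable M (\<lambda>x. (cmod (f x - g x))\<^sup>2)" by (rule ints)
    show "(L2norm M (\<lambda>x. f x - LS \<xi> J f x))\<^sup>2 \<le>
      5 * (\<integral>x. (cmod (f x - g x))\<^sup>2 \<partial>M) + 20 * ((\<Sum>l<m. (cmod (f (\<xi> l) - g (\<xi> l)))\<^sup>2) / m)"
      by (rule L2norm_sub_LS_le[OF ls that(3) m disc[OF J] ints])
  qed
  have "rho_ls \<Omega> M m v N F LS \<le> ennreal (5 * sqrt 2) * sigma_v (norm_mu_xi M \<xi> m) F \<phi> N v"
  proof (rule rho_ls_le_sigma_v[OF _ \<xi>_points])
    fix f J g assume fJg: "f \<in> F" "J \<in> subsets_v N v" "g \<in> dict_span \<phi> J"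
    let ?A = "\<integral>x. (cmod (f x - g x))\<^sup>2 \<partial>M" and ?S = "\<Sum>l<m. (cmod (f (\<xi> l) - g (\<xi> l)))\<^sup>2"
    have A: "?A \<ge> 0" and S: "?S / m \<ge> 0" by (auto intro!: divide_nonneg_nonneg sum_nonneg)
    have "L2norm M (\<lambda>x. f x - LS \<xi> J f x) \<le> 5 * sqrt 2 * sqrt (1 / 2 * ?A + 1 / (2 * real m) * ?S)"
    proof (rule power2_le_imp_le)
      have "(5 * sqrt 2 * sqrt (1 / 2 * ?A + 1 / (2 * real m) * ?S))\<^sup>2 = 50 * (1 / 2 * ?A + 1 / (2 * real m) * ?S)"
        using A S by (simp add: power_mult_distrib)
      \<comment> \<open>The square of \<open>5 * sqrt 2\<close> is 50, and the halves in the mixed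
        norm leave 25 on each part, above the 5 and 20 of \<open>err\<close>.\<close>
      also have "\<dots> = 25 * ?A + 25 * (?S / m)" by simp
      finally show "(L2norm M (\<lambda>x. f x - LS \<xi> J f x))\<^sup>2 \<le>
          (5 * sqrt 2 * sqrt (1 / 2 * ?A + 1 / (2 * real m) * ?S))\<^sup>2"
        using err[OF fJg] A S by linarith
      show "5 * sqrt 2 * sqrt (1 / 2 * ?A + 1 / (2 * real m) * ?S) \<ge> 0" using A S by simp
    qed
    then have "ennreal (L2norm M (\<lambda>x. f x - LS \<xi> J f x)) \<le>
        ennreal (5 * sqrt 2 * sqrt (1 / 2 * ?A + 1 / (2 * real m) * ?S))"
      by (rule ennreal_leI)
    also have "\<dots> = ennreal (5 * sqrt 2) * norm_mu_xi M \<xi> m (\<lambda>x. f x - g x)"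
      unfolding norm_mu_xi_def by (rule ennreal_mult') simp
    finally show "ennreal (L2norm M (\<lambda>x. f x - LS \<xi> J f x)) \<le>
        ennreal (5 * sqrt 2) * norm_mu_xi M \<xi> m (\<lambda>x. f x - g x)" .
  qed simp
  also have "sigma_v (norm_mu_xi M \<xi> m) F \<phi> N v \<le> sigma_2m \<Omega> M m F \<phi> N v"
    unfolding sigma_2m_def by (rule SUP_upper[OF \<xi>_points])
  finally show "rho_ls \<Omega> M m v N F LS \<le> ennreal (5 * sqrt 2) * sigma_2m \<Omega> M m F \<phi> N v"
    by (simp add: mult_left_mono)
  have "rho_ls \<Omega> M m v N F LS \<le> ennreal 5 * sigma_v (supnorm \<Omega>) F \<phi> N v"
  proof (rule rho_ls_le_sigma_v[OF _ \<xi>_points])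
    fix f J g assume fJg: "f \<in> F" "J \<in> subsets_v N v" "g \<in> dict_span \<phi> J"
    show "ennreal (L2norm M (\<lambda>x. f x - LS \<xi> J f x)) \<le> ennreal 5 * supnorm \<Omega> (\<lambda>x. f x - g x)"
    proof (cases "supnorm \<Omega> (\<lambda>x. f x - g x)")
      case (real s)
      have le: "(cmod (f x - g x))\<^sup>2 \<le> s\<^sup>2" if "x \<in> \<Omega>" for x
      proof -
        have "ennreal (cmod (f x - g x)) \<le> ennreal s"
          unfolding real(2)[symmetric] supnorm_def by (rule SUP_upper[OF that])
        then show ?thesis using real(1) by (intro power_mono) auto
      qed
      have "(\<integral>x. (cmod (f x - g x))\<^sup>2 \<partial>M) \<le> (\<integral>x. s\<^sup>2 \<partial>M)"
        using int[OF fJg] le by (intro integral_mono) (auto simp: space)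
      moreover have "(\<Sum>l<m. (cmod (f (\<xi> l) - g (\<xi> l)))\<^sup>2) / m \<le> (\<Sum>l<m. s\<^sup>2) / m"
        using le \<xi> by (intro divide_right_mono sum_mono) auto
      \<comment> \<open>Both averages are at most \<open>s\<^sup>2\<close>, and 5 + 20 = 25.\<close>
      ultimately have "(L2norm M (\<lambda>x. f x - LS \<xi> J f x))\<^sup>2 \<le> (5 * s)\<^sup>2"
        using err[OF fJg] m by (simp add: prob_space power_mult_distrib)
      then have "L2norm M (\<lambda>x. f x - LS \<xi> J f x) \<le> 5 * s"
        by (rule power2_le_imp_le) (use real(1) in simp)
      then have "ennreal (L2norm M (\<lambda>x. f x - LS \<xi> J f x)) \<le> ennreal (5 * s)"
        by (rule ennreal_leI)
      also have "\<dots> = ennreal 5 * supnorm \<Omega> (\<lambda>x. f x - g x)"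
        unfolding real(2) by (rule ennreal_mult') simp
      finally show ?thesis .
    next
      case top
      then show ?thesis by (simp add: ennreal_mult_top)
    qed
  qed simp
  then show "rho_ls \<Omega> M m v N F LS \<le> 5 * sigma_v (supnorm \<Omega>) F \<phi> N v" by simp
qed

end
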